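(* Let $F=\overline{\mathbb{F}}_\ell$ for any prime $\ell$, let $K=\mathbb{F}_q$ be any finite field, and let $n\geq 2$. An irreducible representation of $\mathrm{GL}_n(K)$ over $F$ has at most one Whittaker model (for a given choice of a nontrivial additive character of $K$).
   Context: Let $G=\mathrm{GL}_n(\mathbb{F}_q)$ and let $U\le G$ be the subgroup of upper triangular matrices with all diagonal entries equal to $1$. For a nontrivial additive character $\psi:\mathbb{F}_q\to F^\times$, define the character $\eta_\psi:U\to F^\times$ by $\eta_\psi((x_{ij}))=\psi\left(\sum_{i=1}^{n-1}x_{i,i+1}\right)$. A Whittaker model of an irreducible representation $\pi$ of $G$ over $F$ (with respect to $\psi$) is a realization of $\pi$ as a subrepresentation of $\mathrm{Ind}_U^G(\eta_\psi)=F[G]\otimes_{F[U]}\eta_\psi$, i.e. a nonzero $G$-homomorphism $\pi\to\mathrm{Ind}_U^G(\eta_\psi)$ up to scalar. Having at most one Whittaker model means $\dim_F\mathrm{Hom}_G(\pi,\mathrm{Ind}_U^G(\eta_\psi))\le 1$. *)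

theory Defs
  imports
    "HOL-Algebra.Algebraic_Closure"
    "HOL-Algebra.Free_Abelian_Groups"
    "Jordan_Normal_Form.VS_Connect"
begin

locale group_representation =
  group G + vectorspace "class_ring :: 'f :: field ring" V
  for G :: "('g, 'b) monoid_scheme" (structure)
    and V :: "('f :: field, 'v, 'c) module_scheme"
    and \<rho> :: "'g \<Rightarrow> 'v \<Rightarrow> 'v" +
  assumes rep_linear: "g \<in> carrier G \<Longrightarrow> \<rho> g \<in> module_hom class_ring V V"
    and rep_one: "v \<in> carrier V \<Longrightarrow> \<rho> \<one>\<^bsub>G\<^esub> v = v"
    and rep_mult: "\<lbrakk>g \<in> carrier G; h \<in> carrier G; v \<in> carrier V\<rbrakk>
      \<Longrightarrow> \<rho> (g \<otimes>\<^bsub>G\<^esub> h) v = \<rho> g (\<rho> h v)"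

locale irreducible_representation = group_representation +
  assumes nonzero: "carrier V \<noteq> {\<zero>\<^bsub>V\<^esub>}"
    and irreducible: "\<lbrakk>VectorSpace.subspace class_ring W V;
        \<And>g. g \<in> carrier G \<Longrightarrow> \<rho> g ` W \<subseteq> W\<rbrakk>
      \<Longrightarrow> W = {\<zero>\<^bsub>V\<^esub>} \<or> W = carrier V"

text \<open>
  The vector space of \<open>G\<close>-homomorphisms.  Its elements are extensional functions, so that
  a homomorphism is determined by its values on the carrier of \<open>V\<close>.  The fields \<open>mult\<close> and
  \<open>one\<close> of a module record carry no information.
\<close>

definition rep_Hom ::
  "('g, 'b) monoid_scheme \<Rightarrow> ('f :: field, 'v, 'c) module_scheme \<Rightarrow> ('g \<Rightarrow> 'v \<Rightarrow> 'v) \<Rightarrow>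
   ('f, 'w, 'd) module_scheme \<Rightarrow> ('g \<Rightarrow> 'w \<Rightarrow> 'w) \<Rightarrow> ('f, 'v \<Rightarrow> 'w) module"
  where "rep_Hom G V \<rho> W \<sigma> =
    \<lparr>carrier = {T \<in> module_hom class_ring V W \<inter> extensional (carrier V).
         \<forall>g\<in>carrier G. \<forall>v\<in>carrier V. T (\<rho> g v) = \<sigma> g (T v)},
     monoid.mult = undefined, one = undefined,
     ring.zero = (\<lambda>v\<in>carrier V. \<zero>\<^bsub>W\<^esub>),
     add = (\<lambda>S T. \<lambda>v\<in>carrier V. S v \<oplus>\<^bsub>W\<^esub> T v),
     smult = (\<lambda>c T. \<lambda>v\<in>carrier V. c \<odot>\<^bsub>W\<^esub> T v)\<rparr>"

definition group_algebra :: "('g, 'b) monoid_scheme \<Rightarrow> ('g \<Rightarrow> 'f :: field) ring"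
  where "group_algebra G =
    \<lparr>carrier = {x. finite {g. x g \<noteq> 0} \<and> {g. x g \<noteq> 0} \<subseteq> carrier G},
     monoid.mult = (\<lambda>x y g. \<Sum>(a, b) | x a \<noteq> 0 \<and> y b \<noteq> 0 \<and> a \<otimes>\<^bsub>G\<^esub> b = g. x a * y b),
     one = (\<lambda>g. if g = \<one>\<^bsub>G\<^esub> then 1 else 0),
     ring.zero = (\<lambda>_. 0),
     add = (\<lambda>x y g. x g + y g)\<rparr>"

definition ga_single :: "'g \<Rightarrow> 'f :: field \<Rightarrow> 'g \<Rightarrow> 'f"
  where "ga_single g c = (\<lambda>h. if h = g then c else 0)"

text \<open>
  The tensor product over a possibly non-commutative ring \<open>R\<close> of a right \<open>R\<close>-module \<open>M\<close>
  (action \<open>ract\<close>) and a left \<open>R\<close>-module \<open>N\<close> (action \<open>lact\<close>): the free abelian group on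
  \<open>M \<times> N\<close> modulo the subgroup generated by the usual relations.  Only the additive
  structure of the records \<open>M\<close> and \<open>N\<close> is used.  The result is written
  multiplicatively, its elements being cosets.
\<close>

definition tensor_relations ::
  "('r, 'x) ring_scheme \<Rightarrow> ('m, 'y) ring_scheme \<Rightarrow> ('m \<Rightarrow> 'r \<Rightarrow> 'm) \<Rightarrow>
   ('n, 'z) ring_scheme \<Rightarrow> ('r \<Rightarrow> 'n \<Rightarrow> 'n) \<Rightarrow> ('m \<times> 'n \<Rightarrow>\<^sub>0 int) set"
  where "tensor_relations R M ract N lact =
    generate (free_Abelian_group (carrier M \<times> carrier N))
     ({frag_of (x \<oplus>\<^bsub>M\<^esub> x', y) - frag_of (x, y) - frag_of (x', y) | x x' y.
         x \<in> carrier M \<and> x' \<in> carrier M \<and> y \<in> carrier N} \<union>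
      {frag_of (x, y \<oplus>\<^bsub>N\<^esub> y') - frag_of (x, y) - frag_of (x, y') | x y y'.
         x \<in> carrier M \<and> y \<in> carrier N \<and> y' \<in> carrier N} \<union>
      {frag_of (ract x r, y) - frag_of (x, lact r y) | x r y.
         x \<in> carrier M \<and> r \<in> carrier R \<and> y \<in> carrier N})"

definition tensor_product ::
  "('r, 'x) ring_scheme \<Rightarrow> ('m, 'y) ring_scheme \<Rightarrow> ('m \<Rightarrow> 'r \<Rightarrow> 'm) \<Rightarrow>
   ('n, 'z) ring_scheme \<Rightarrow> ('r \<Rightarrow> 'n \<Rightarrow> 'n) \<Rightarrow> ('m \<times> 'n \<Rightarrow>\<^sub>0 int) set monoid"
  where "tensor_product R M ract N lact =
    free_Abelian_group (carrier M \<times> carrier N) Mod tensor_relations R M ract N lact"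

text \<open>
  The endomorphism \<open>f \<otimes> id\<close> of the tensor product, for a right \<open>R\<close>-linear endomorphism \<open>f\<close>
  of \<open>M\<close>.  All the cosets in the union coincide.
\<close>

definition tensor_map_left ::
  "('r, 'x) ring_scheme \<Rightarrow> ('m, 'y) ring_scheme \<Rightarrow> ('m \<Rightarrow> 'r \<Rightarrow> 'm) \<Rightarrow>
   ('n, 'z) ring_scheme \<Rightarrow> ('r \<Rightarrow> 'n \<Rightarrow> 'n) \<Rightarrow> ('m \<Rightarrow> 'm) \<Rightarrow>
   ('m \<times> 'n \<Rightarrow>\<^sub>0 int) set \<Rightarrow> ('m \<times> 'n \<Rightarrow>\<^sub>0 int) set"
  where "tensor_map_left R M ract N lact f C =
    (\<Union>z\<in>C. tensor_relations R M ract N lact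
       #>\<^bsub>free_Abelian_group (carrier M \<times> carrier N)\<^esub>
       frag_extend (\<lambda>(x, y). frag_of (f x, y)) z)"

text \<open>
  For a subgroup \<open>U\<close> of \<open>G\<close> and a character \<open>\<eta>\<close> of \<open>U\<close>, the group algebra of \<open>U\<close> acts on the
  left of the ground field through \<open>\<eta>\<close> (extended linearly) and on the right of the group
  algebra of \<open>G\<close> by multiplication.  The induced representation is the tensor product of the
  two, with its left action of the group algebra of \<open>G\<close>; the ground field embeds there
  as the multiples of \<open>1\<close>.
\<close>

definition char_lact :: "('g \<Rightarrow> 'f :: field) \<Rightarrow> ('g \<Rightarrow> 'f) \<Rightarrow> 'f \<Rightarrow> 'f"
  where "char_lact \<eta> r c = (\<Sum>u | r u \<noteq> 0. r u * \<eta> u) * c"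

type_synonym ('g, 'f) ind_space = "(('g \<Rightarrow> 'f) \<times> 'f \<Rightarrow>\<^sub>0 int) set"

definition ind_act ::
  "('g, 'b) monoid_scheme \<Rightarrow> 'g set \<Rightarrow> ('g \<Rightarrow> 'f :: field) \<Rightarrow> ('g \<Rightarrow> 'f) \<Rightarrow>
   ('g, 'f) ind_space \<Rightarrow> ('g, 'f) ind_space"
  where "ind_act G U \<eta> a =
    tensor_map_left (group_algebra (G\<lparr>carrier := U\<rparr>))
      (group_algebra G) (monoid.mult (group_algebra G)) class_ring (char_lact \<eta>)
      (monoid.mult (group_algebra G) a)"

definition ind_module ::
  "('g, 'b) monoid_scheme \<Rightarrow> 'g set \<Rightarrow> ('g \<Rightarrow> 'f :: field) \<Rightarrow> ('f, ('g, 'f) ind_space) module"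
  where "ind_module G U \<eta> =
    (let T = tensor_product (group_algebra (G\<lparr>carrier := U\<rparr>))
               (group_algebra G) (monoid.mult (group_algebra G)) class_ring (char_lact \<eta>)
     in \<lparr>carrier = carrier T, monoid.mult = undefined, one = undefined,
         ring.zero = \<one>\<^bsub>T\<^esub>, add = monoid.mult T,
         smult = (\<lambda>c. ind_act G U \<eta> (ga_single \<one>\<^bsub>G\<^esub> c))\<rparr>)"

definition ind_rep ::
  "('g, 'b) monoid_scheme \<Rightarrow> 'g set \<Rightarrow> ('g \<Rightarrow> 'f :: field) \<Rightarrow> 'g \<Rightarrow>
   ('g, 'f) ind_space \<Rightarrow> ('g, 'f) ind_space"
  where "ind_rep G U \<eta> g = ind_act G U \<eta> (ga_single g 1)"

definition GL :: "nat \<Rightarrow> 'k :: field mat monoid"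
  where "GL n = units_of (ring_mat TYPE('k) n ())"

definition unitriangular :: "nat \<Rightarrow> 'k :: field mat set"
  where "unitriangular n =
    {x \<in> carrier_mat n n. upper_triangular x \<and> (\<forall>i<n. x $$ (i, i) = 1)}"

definition additive_character :: "('k :: field \<Rightarrow> 'f :: field) \<Rightarrow> bool"
  where "additive_character \<psi> \<longleftrightarrow>
    \<psi> \<in> hom (add_monoid (class_ring :: 'k ring)) (units_of (class_ring :: 'f ring))"

text \<open>Matrix indices start at \<open>0\<close>.\<close>

definition whittaker_char :: "nat \<Rightarrow> ('k :: field \<Rightarrow> 'f :: field) \<Rightarrow> 'k mat \<Rightarrow> 'f"
  where "whittaker_char n \<psi> x = \<psi> (\<Sum>i<n - 1. x $$ (i, i + 1))"

definition Whittaker_Hom ::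
  "nat \<Rightarrow> ('k :: field \<Rightarrow> 'f :: field) \<Rightarrow> ('f, 'v, 'c) module_scheme \<Rightarrow>
   ('k mat \<Rightarrow> 'v \<Rightarrow> 'v) \<Rightarrow> ('f, 'v \<Rightarrow> ('k mat, 'f) ind_space) module"
  where "Whittaker_Hom n \<psi> V \<rho> =
    rep_Hom (GL n) V \<rho>
      (ind_module (GL n) (unitriangular n) (whittaker_char n \<psi>))
      (ind_rep (GL n) (unitriangular n) (whittaker_char n \<psi>))"

text \<open>
  The dimension in the library is the least cardinality of a finite generating set, which is
  only meaningful together with the existence of such a set.
\<close>

definition at_most_one_Whittaker_model ::
  "nat \<Rightarrow> ('k :: field \<Rightarrow> 'f :: field) \<Rightarrow> ('f, 'v, 'c) module_scheme \<Rightarrow>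
   ('k mat \<Rightarrow> 'v \<Rightarrow> 'v) \<Rightarrow> bool"
  where "at_most_one_Whittaker_model n \<psi> V \<rho> \<longleftrightarrow>
    vectorspace.fin_dim class_ring (Whittaker_Hom n \<psi> V \<rho>) \<and>
    vectorspace.dim class_ring (Whittaker_Hom n \<psi> V \<rho>) \<le> 1"

end

theory Submission
  imports Defs "HOL-Algebra.Sylow"
begin

text \<open>
  The order of \<open>U\<close>, a power of \<open>q\<close>, is invertible in \<open>F\<close>: a nontrivial additive character of \<open>K\<close>
  exists only if the characteristics of \<open>F\<close> and \<open>K\<close> differ.  So \<open>\<eta>\<close> has an idempotent
  \<open>e\<close> in the group algebra of \<open>U\<close>, and \<open>x \<otimes> c \<mapsto> c x e\<close> identifies the induced representation
  with the left ideal \<open>F[G]e\<close>.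

  The Hecke algebra \<open>e F[G] e\<close> is commutative by Gelfand's trick: its elements are the functions that
  are \<open>\<eta>\<close>-equivariant on both sides, and they are invariant under transposition along the
  antidiagonal, an anti-automorphism which preserves \<open>U\<close> and \<open>\<eta>\<close>.  By the Bruhat decomposition
  this has to be checked on monomial matrices only; one in the support of such a function consists of
  scalar blocks along the antidiagonal and is therefore symmetric.

  An irreducible subrepresentation is a minimal left ideal \<open>A\<close> of \<open>F[G]\<close> contained in \<open>F[G]e\<close>.
  Then \<open>eA\<close> is a simple module over the commutative algebra \<open>e F[G] e\<close>, hence a line because \<open>F\<close>
  is algebraically closed.  As \<open>x 1 = (e x) 1\<close> on \<open>F[G]e\<close>, an equivariant map from \<open>A\<close> to \<open>F[G]e\<close>
  is determined by its value on this line.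
\<close>

text \<open>The characteristic of \<open>F\<close> may divide the order of \<open>G\<close>, so F[G]
  need not be semisimple and the induced representation need not decompose into irreducibles. What
  replaces a decomposition is the functional \<open>x \<mapsto> x \<one>\<close>, which makes F[G] a
  symmetric algebra. It takes the same value on a product and on the product in reverse order, and
  its kernel contains no nonzero left ideal, because translating \<open>x\<close> by the inverse of
  \<open>g\<close> moves the coefficient at \<open>g\<close> to \<open>\<one>\<close>. The first
  property gives the identity between \<open>x\<close> and \<open>e x\<close> at
  \<open>\<one>\<close>. The second shows that eA is nonzero and recovers an equivariant map from
  the values of its images at \<open>\<one>\<close>. The same functional explains why a map defined
  only on A, and not on all of F[G]e, can be handled: the argument never extends it beyond
  A.\<close>

section \<open>Descents and the characteristic\<close>

text \<open>Such a \<open>\<rho>\<close> reverses each block of some partition of \<open>{..<n}\<close> into intervals.\<close>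

lemma involution_of_descents:
  fixes \<rho> :: "nat \<Rightarrow> nat" and t :: "nat \<Rightarrow> 'a"
  assumes bij: "bij_betw \<rho> {..<n} {..<n}"
    and step: "\<And>a. Suc a < n \<Longrightarrow> \<rho> a < \<rho> (Suc a) \<or> (\<rho> a = Suc (\<rho> (Suc a)) \<and> t a = t (Suc a))"
    and j: "j < n"
  shows "\<rho> (\<rho> j) = j \<and> t (\<rho> j) = t j"
proof -
  have range: "\<rho> i < n" if "i < n" for i
    using bij_betwE[OF bij] that by simp
  have inj: "i = k" if "\<rho> i = \<rho> k" "i < n" "k < n" for i k
    using inj_onD[OF bij_betw_imp_inj_on[OF bij]] that by simp
  \<comment> \<open>From \<open>j\<close> on, \<open>\<rho>\<close> descends in unit steps until it
    rises above \<open>\<rho> j\<close>, and then it stays above. A descending run uses up all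
    values between its end and \<open>\<rho> j\<close>, so by injectivity the next ascent jumps past
    \<open>\<rho> j\<close>.\<close>
  have run: "\<rho> j < \<rho> k \<or> (\<forall>m\<in>{j..k}. \<rho> m + (m - j) = \<rho> j \<and> t m = t j)"
    if "j \<le> k" "k < n" for j k
    using that
  proof (induction k rule: dec_induct)
    case base
    then show ?case by simp
  next
    case (step k)
    have k: "\<rho> k < \<rho> (Suc k) \<or> (\<rho> k = Suc (\<rho> (Suc k)) \<and> t k = t (Suc k))"
      using assms(2)[of k] step.prems by simp
    have ne: "\<rho> (Suc k) \<noteq> \<rho> m" if "m \<le> k" for m
      using inj[of "Suc k" m] that step.prems by auto
    have "\<rho> j < \<rho> k \<or> (\<forall>m\<in>{j..k}. \<rho> m + (m - j) = \<rho> j \<and> t m = t j)"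
      using step by simp
    then show ?case
    proof
      assume "\<rho> j < \<rho> k"
      then show ?thesis using k ne[of j] step.hyps by linarith
    next
      assume r: "\<forall>m\<in>{j..k}. \<rho> m + (m - j) = \<rho> j \<and> t m = t j"
      have rk: "\<rho> k + (k - j) = \<rho> j" "t k = t j"
        using bspec[OF r, of k] step.hyps by simp_all
      show ?thesis
      proof (cases "\<rho> k < \<rho> (Suc k)")
        case True
        have "\<rho> j < \<rho> (Suc k)"
        proof (rule ccontr)
          assume le: "\<not> \<rho> j < \<rho> (Suc k)"
          \<comment> \<open>The place in the run where \<open>\<rho>\<close> has already taken the
            value \<open>\<rho> (Suc k)\<close>.\<close>
          define m where "m = j + (\<rho> j - \<rho> (Suc k))"
          have "m \<in> {j..k}" using True rk(1) step.hyps le by (auto simp: m_def)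
          then have "\<rho> m + (m - j) = \<rho> j" "m \<le> k" using bspec[OF r, of m] by simp_all
          then show False using ne[of m] le by (simp add: m_def)
        qed
        then show ?thesis by simp
      next
        case False
        then have "\<rho> k = Suc (\<rho> (Suc k))" "t k = t (Suc k)" using k by auto
        then have "\<rho> (Suc k) + (Suc k - j) = \<rho> j \<and> t (Suc k) = t j"
          using rk step.hyps by (simp add: Suc_diff_le)
        then have all: "\<forall>m\<in>insert (Suc k) {j..k}. \<rho> m + (m - j) = \<rho> j \<and> t m = t j"
          using r by blast
        have "{j..Suc k} = insert (Suc k) {j..k}"
          using step.hyps by (simp add: atLeastAtMostSuc_conv)
        then show ?thesis using all by (simp only: disjI2)
      qed
    qed
  qed
  show ?thesis
    using j
  proof (induction j rule: less_induct)
    case (less j)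
    define k where "k = \<rho> j"
    have kn: "k < n" using range[OF less.prems] by (simp add: k_def)
    consider "k < j" | "k = j" | "j < k" by linarith
    then show ?case
    proof cases
      case 1
      then have "\<rho> (\<rho> k) = \<rho> j" "t (\<rho> k) = t k" using less.IH[of k] kn by (simp_all add: k_def)
      then have "\<rho> k = j" using inj[OF _ range[OF kn] less.prems] by blast
      then show ?thesis using \<open>t (\<rho> k) = t k\<close> by (simp add: k_def)
    next
      case 2
      then show ?thesis by (simp add: k_def)
    next
      case 3
      \<comment> \<open>Here \<open>j\<close> starts a block, and its preimage \<open>m\<close>
        should be the end. The induction hypothesis excludes \<open>m < j\<close>. Since
        \<open>\<rho> m = j < \<rho> j\<close>, the run from \<open>j\<close> reaches
        \<open>m\<close>, and its last equation reads \<open>m = \<rho> j\<close>.\<close>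
      have "j \<in> \<rho> ` {..<n}" using bij_betw_imp_surj_on[OF bij] less.prems by simp
      then obtain m where m: "m < n" "\<rho> m = j" by auto
      have "m \<noteq> j" using 3 m by (auto simp: k_def)
      moreover have "\<not> m < j" using less.IH[of m] m 3 by (auto simp: k_def)
      ultimately have jm: "j < m" by simp
      have "\<rho> m + (m - j) = \<rho> j \<and> t m = t j"
      proof -
        have "\<not> \<rho> j < \<rho> m" using m(2) 3 by (simp add: k_def)
        then have "\<forall>i\<in>{j..m}. \<rho> i + (i - j) = \<rho> j \<and> t i = t j"
          using run[OF less_imp_le[OF jm] m(1)] by blast
        from bspec[OF this, of m] show ?thesis using jm by simp
      qed
      then have tm: "t m = t j" and "\<rho> m + (m - j) = \<rho> j" by blast+
      then have "m = k" using m(2) jm unfolding k_def by linarith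
      then show ?thesis using m(2) tm unfolding k_def by metis
    qed
  qed
qed

text \<open>Cauchy's theorem, drawn from Sylow's: a subgroup of the additive group whose order is a
  positive power of \<open>l\<close> contains some \<open>h \<noteq> 0\<close> killed by that power.
  Cancelling \<open>h\<close> makes \<open>l\<close> vanish in the field.\<close>

lemma prime_dvd_card_field:
  assumes l: "prime l" and dvd: "l dvd card (UNIV :: 'k :: {field, finite} set)"
  shows "l = CHAR('k)"
proof -
  let ?A = "add_monoid (class_ring :: 'k ring)"
  interpret A: group ?A by (rule abelian_group.a_group[OF ring.is_abelian_group[OF class_ring.ring_axioms]])
  define q where "q = card (UNIV :: 'k set)"
  have q: "q > 0" by (simp add: q_def card_gt_0_iff)
  define a where "a = multiplicity l q"
  have "Coset.order ?A = l ^ a * (q div l ^ a)"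
    by (simp add: Coset.order_def a_def q_def[symmetric] multiplicity_dvd)
  then obtain H where H: "subgroup H ?A" "card H = l ^ a"
    using sylow_thm[OF l A.is_group] by auto
  have a: "a > 0"
    using dvd l q by (simp add: a_def q_def prime_multiplicity_gt_zero_iff)
  have "1 < l ^ a" using a prime_gt_1_nat[OF l] by (rule one_less_power[rotated])
  then have "\<not> H \<subseteq> {0}" using H(2) card_mono[of "{0}" H] by auto
  then obtain h where h: "h \<in> H" "h \<noteq> 0" by auto
  interpret H: group "?A\<lparr>carrier := H\<rparr>"
    by (rule A.subgroup_imp_group[OF H(1)])
  have pow: "h [^]\<^bsub>?A\<lparr>carrier := H\<rparr>\<^esub> (m :: nat) = of_nat m * h" for m
    by (induction m) (auto simp: nat_pow_def algebra_simps)
  have "h [^]\<^bsub>?A\<lparr>carrier := H\<rparr>\<^esub> (Coset.order (?A\<lparr>carrier := H\<rparr>)) = 0"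
    using H.pow_order_eq_1[of h] h by simp
  then have "of_nat (l ^ a) * h = 0"
    unfolding pow by (simp add: Coset.order_def H(2))
  then have "of_nat l = (0 :: 'k)" using h(2) by simp
  then have "CHAR('k) dvd l" by (simp add: of_nat_eq_0_iff_char_dvd)
  then show ?thesis
    using l CHAR_not_1'[where 'a = 'k] by (auto simp: prime_nat_iff)
qed

lemma additive_character_add:
  assumes "additive_character \<psi>"
  shows "\<psi> (a + b) = \<psi> a * \<psi> b" "\<psi> 0 = 1" "\<psi> a \<noteq> 0"
proof -
  have hom: "\<psi> \<in> hom (add_monoid (class_ring :: 'a ring)) (units_of (class_ring :: 'b ring))"
    using assms by (simp add: additive_character_def)
  have unit: "\<psi> x \<in> Units (class_ring :: 'b ring)" for x
    using hom by (auto simp: hom_def units_of_def)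
  show nz: "\<psi> a \<noteq> 0" for a
    using unit[of a] by (auto simp: Units_def)
  show add: "\<psi> (a + b) = \<psi> a * \<psi> b" for a b
    using hom by (auto simp: hom_def units_of_def)
  show "\<psi> 0 = 1" using add[of 0 0] nz[of 0] by simp
qed

text \<open>Otherwise both fields would have the same characteristic \<open>p\<close>. Then every
  value of \<open>\<psi>\<close> is a \<open>p\<close>-th root of unity, and injectivity of the
  Frobenius map leaves only 1.\<close>

lemma card_field_nonzero:
  fixes \<psi> :: "'k :: {field, finite} \<Rightarrow> 'f :: field"
  assumes \<psi>: "additive_character \<psi>" and nontrivial: "\<exists>x. \<psi> x \<noteq> 1"
  shows "of_nat (card (UNIV :: 'k set)) \<noteq> (0 :: 'f)"
proof
  assume "of_nat (card (UNIV :: 'k set)) = (0 :: 'f)"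
  then have dvd: "CHAR('f) dvd card (UNIV :: 'k set)" by (simp add: of_nat_eq_0_iff_char_dvd)
  then have "CHAR('f) > 0" by (auto intro!: Nat.gr0I)
  then have prime: "prime CHAR('f)" by (rule prime_CHAR_semidom)
  then have char: "CHAR('f) = CHAR('k)" using dvd by (rule prime_dvd_card_field)
  have "\<psi> x = 1" for x
  proof -
    have pow: "\<psi> (of_nat m * x) = \<psi> x ^ m" for m
      by (induction m) (simp_all add: additive_character_add[OF \<psi>] distrib_right)
    have "\<psi> x ^ CHAR('f) = 1"
      using pow[of "CHAR('f)"] by (simp add: char additive_character_add(2)[OF \<psi>])
    moreover have "(\<psi> x - 1 + 1) ^ CHAR('f) = (\<psi> x - 1) ^ CHAR('f) + 1 ^ CHAR('f)"
      by (rule freshmans_dream[OF prime refl])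
    ultimately show ?thesis by simp
  qed
  with nontrivial show False by blast
qed

section \<open>The group algebra of a finite group\<close>

locale finite_group = group +
  assumes finite_carrier: "finite (carrier G)"
begin

abbreviation conv (infixl "\<star>" 70)
  where "x \<star> y \<equiv> x \<otimes>\<^bsub>group_algebra G\<^esub> y"

lemma carrier_group_algebra_iff:
  "x \<in> carrier (group_algebra G) \<longleftrightarrow> (\<forall>g. g \<notin> carrier G \<longrightarrow> x g = 0)"
  unfolding group_algebra_def using finite_subset[OF _ finite_carrier, of "{g. x g \<noteq> 0}"] by auto

lemma group_algebra_outside:
  "x \<in> carrier (group_algebra G) \<Longrightarrow> g \<notin> carrier G \<Longrightarrow> x g = 0"
  by (simp add: carrier_group_algebra_iff)

lemma conv_apply:
  assumes x: "x \<in> carrier (group_algebra G)" and y: "y \<in> carrier (group_algebra G)"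
  shows "(x \<star> y) g = (if g \<in> carrier G then \<Sum>h\<in>carrier G. x h * y (inv h \<otimes> g) else 0)"
proof (cases "g \<in> carrier G")
  case False
  have empty: "{(a, b). x a \<noteq> 0 \<and> y b \<noteq> 0 \<and> a \<otimes> b = g} = {}"
    using False x y by (force simp: carrier_group_algebra_iff)
  have "(x \<star> y) g = (\<Sum>(a, b) | x a \<noteq> 0 \<and> y b \<noteq> 0 \<and> a \<otimes> b = g. x a * y b)"
    by (simp add: group_algebra_def)
  also have "\<dots> = 0" by (simp only: empty sum.empty)
  finally have "(x \<star> y) g = 0" .
  with False show ?thesis by simp
next
  case True
  have "(x \<star> y) g = (\<Sum>(a, b) | x a \<noteq> 0 \<and> y b \<noteq> 0 \<and> a \<otimes> b = g. x a * y b)"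
    by (simp add: group_algebra_def)
  also have "\<dots> = (\<Sum>h | h \<in> carrier G \<and> x h \<noteq> 0 \<and> y (inv h \<otimes> g) \<noteq> 0. x h * y (inv h \<otimes> g))"
  proof (rule sum.reindex_bij_witness[where i = "\<lambda>h. (h, inv h \<otimes> g)" and j = fst])
    fix p assume "p \<in> {(a, b). x a \<noteq> 0 \<and> y b \<noteq> 0 \<and> a \<otimes> b = g}"
    then obtain a b where p: "p = (a, b)" "x a \<noteq> 0" "y b \<noteq> 0" "a \<otimes> b = g" by auto
    then have ab: "a \<in> carrier G" "b \<in> carrier G"
      using x y by (auto simp: carrier_group_algebra_iff)
    then have "inv a \<otimes> g = b" using p(4) by (auto simp: m_assoc[symmetric])
    with p ab show "(fst p, inv fst p \<otimes> g) = p"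
      "fst p \<in> {h. h \<in> carrier G \<and> x h \<noteq> 0 \<and> y (inv h \<otimes> g) \<noteq> 0}"
      "x (fst p) * y (inv fst p \<otimes> g) = (case p of (a, b) \<Rightarrow> x a * y b)"
      by simp_all
  qed (use True in \<open>auto simp: m_assoc[symmetric]\<close>)
  also have "\<dots> = (\<Sum>h\<in>carrier G. x h * y (inv h \<otimes> g))"
    using finite_carrier by (intro sum.mono_neutral_left) auto
  finally show ?thesis using True by simp
qed

lemma conv_closed [simp]:
  assumes "x \<in> carrier (group_algebra G)" "y \<in> carrier (group_algebra G)"
  shows "x \<star> y \<in> carrier (group_algebra G)"
  using assms by (subst carrier_group_algebra_iff) (simp add: conv_apply)

lemma bij_betw_left_mult: "h \<in> carrier G \<Longrightarrow> bij_betw ((\<otimes>) h) (carrier G) (carrier G)"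
  by (rule bij_betw_byWitness[where f' = "(\<otimes>) (inv h)"]) (auto simp: m_assoc[symmetric])

lemma sum_left_mult:
  "h \<in> carrier G \<Longrightarrow> (\<Sum>g\<in>carrier G. f (h \<otimes> g)) = sum f (carrier G)"
  by (rule sum.reindex_bij_betw[OF bij_betw_left_mult])

lemma sum_inv: "(\<Sum>g\<in>carrier G. f (inv g)) = sum f (carrier G)"
  by (rule sum.reindex_bij_betw, rule bij_betw_byWitness[where f' = "m_inv G"]) auto

lemma conv_apply':
  assumes x: "x \<in> carrier (group_algebra G)" and y: "y \<in> carrier (group_algebra G)"
    and g: "g \<in> carrier G"
  shows "(x \<star> y) g = (\<Sum>h\<in>carrier G. x (g \<otimes> inv h) * y h)"
proof -
  have "(\<Sum>h\<in>carrier G. x (g \<otimes> inv h) * y h) = (\<Sum>h\<in>carrier G. x (g \<otimes> h) * y (inv h))"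
    by (subst sum_inv[symmetric]) simp
  also have "\<dots> = (\<Sum>h\<in>carrier G. x (g \<otimes> (inv g \<otimes> h)) * y (inv (inv g \<otimes> h)))"
    by (rule sum_left_mult[symmetric]) (use g in simp)
  also have "\<dots> = (\<Sum>h\<in>carrier G. x h * y (inv h \<otimes> g))"
    using g by (intro sum.cong) (auto simp: m_assoc[symmetric] inv_mult_group)
  finally show ?thesis using g by (simp add: conv_apply[OF x y])
qed

lemma conv_assoc:
  assumes x: "x \<in> carrier (group_algebra G)" and y: "y \<in> carrier (group_algebra G)"
    and z: "z \<in> carrier (group_algebra G)"
  shows "x \<star> y \<star> z = x \<star> (y \<star> z)"
proof
  fix g
  show "(x \<star> y \<star> z) g = (x \<star> (y \<star> z)) g"
  proof (cases "g \<in> carrier G")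
    case True
    have "(x \<star> y \<star> z) g = (\<Sum>h\<in>carrier G. \<Sum>k\<in>carrier G. x k * y (inv k \<otimes> h) * z (inv h \<otimes> g))"
      using True x y z by (simp add: conv_apply sum_distrib_right)
    also have "\<dots> = (\<Sum>k\<in>carrier G. \<Sum>h\<in>carrier G. x k * y (inv k \<otimes> h) * z (inv h \<otimes> g))"
      by (rule sum.swap)
    also have "\<dots> = (\<Sum>k\<in>carrier G. \<Sum>h\<in>carrier G. x k * (y h * z (inv h \<otimes> (inv k \<otimes> g))))"
    proof (rule sum.cong[OF refl])
      fix k assume k: "k \<in> carrier G"
      have "(\<Sum>h\<in>carrier G. x k * y (inv k \<otimes> h) * z (inv h \<otimes> g))
          = (\<Sum>h\<in>carrier G. x k * y (inv k \<otimes> (k \<otimes> h)) * z (inv (k \<otimes> h) \<otimes> g))"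
        by (rule sum_left_mult[OF k, symmetric])
      also have "\<dots> = (\<Sum>h\<in>carrier G. x k * (y h * z (inv h \<otimes> (inv k \<otimes> g))))"
        using k True
        by (intro sum.cong refl) (simp add: m_assoc inv_mult_group, simp add: m_assoc[symmetric] mult.assoc)
      finally show "(\<Sum>h\<in>carrier G. x k * y (inv k \<otimes> h) * z (inv h \<otimes> g))
          = (\<Sum>h\<in>carrier G. x k * (y h * z (inv h \<otimes> (inv k \<otimes> g))))" .
    qed
    also have "\<dots> = (x \<star> (y \<star> z)) g"
      using True x y z by (simp add: conv_apply sum_distrib_left)
    finally show ?thesis .
  qed (use x y z in \<open>simp add: group_algebra_outside[OF conv_closed]\<close>)
qed

lemma group_algebra_add [simp]: "x \<oplus>\<^bsub>group_algebra G\<^esub> y = (\<lambda>g. x g + y g)"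
  by (simp add: group_algebra_def)

lemma ga_add_closed [simp]:
  assumes "x \<in> carrier (group_algebra G)" "y \<in> carrier (group_algebra G)"
  shows "(\<lambda>g. x g + y g) \<in> carrier (group_algebra G)"
  using assms by (simp add: carrier_group_algebra_iff)

lemma ga_scale_closed [simp]:
  assumes "x \<in> carrier (group_algebra G)"
  shows "(\<lambda>g. c * x g) \<in> carrier (group_algebra G)"
  using assms by (simp add: carrier_group_algebra_iff)

lemma ga_zero_closed [simp]: "(\<lambda>g. 0) \<in> carrier (group_algebra G)"
  by (simp add: carrier_group_algebra_iff)

lemma ga_single_closed [simp]: "a \<in> carrier G \<Longrightarrow> ga_single a c \<in> carrier (group_algebra G)"
  by (auto simp: carrier_group_algebra_iff ga_single_def)

lemma conv_add_left:
  assumes "x \<in> carrier (group_algebra G)" "y \<in> carrier (group_algebra G)"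
    "z \<in> carrier (group_algebra G)"
  shows "(\<lambda>g. x g + y g) \<star> z = (\<lambda>g. (x \<star> z) g + (y \<star> z) g)"
  using assms by (auto simp: conv_apply sum.distrib distrib_right)

lemma conv_add_right:
  assumes "x \<in> carrier (group_algebra G)" "y \<in> carrier (group_algebra G)"
    "z \<in> carrier (group_algebra G)"
  shows "z \<star> (\<lambda>g. x g + y g) = (\<lambda>g. (z \<star> x) g + (z \<star> y) g)"
  using assms by (auto simp: conv_apply sum.distrib distrib_left)

lemma conv_scale_left:
  assumes "x \<in> carrier (group_algebra G)" "z \<in> carrier (group_algebra G)"
  shows "(\<lambda>g. c * x g) \<star> z = (\<lambda>g. c * (x \<star> z) g)"
  using assms by (auto simp: conv_apply sum_distrib_left mult.assoc)

lemma conv_scale_right: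
  assumes "x \<in> carrier (group_algebra G)" "z \<in> carrier (group_algebra G)"
  shows "z \<star> (\<lambda>g. c * x g) = (\<lambda>g. c * (z \<star> x) g)"
  using assms by (auto simp: conv_apply sum_distrib_left mult_ac)

lemma conv_zero_left [simp]: "z \<in> carrier (group_algebra G) \<Longrightarrow> (\<lambda>g. 0) \<star> z = (\<lambda>g. 0)"
  by (auto simp: conv_apply)

lemma conv_zero_right [simp]: "z \<in> carrier (group_algebra G) \<Longrightarrow> z \<star> (\<lambda>g. 0) = (\<lambda>g. 0)"
  by (auto simp: conv_apply)

lemma ga_single_conv:
  assumes a: "a \<in> carrier G" and x: "x \<in> carrier (group_algebra G)" and g: "g \<in> carrier G"
  shows "(ga_single a c \<star> x) g = c * x (inv a \<otimes> g)"
proof -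
  have "(ga_single a c \<star> x) g = (\<Sum>h\<in>carrier G. if h = a then c * x (inv a \<otimes> g) else 0)"
    using g by (subst conv_apply[OF ga_single_closed[OF a] x])
      (auto simp: ga_single_def intro!: sum.cong)
  also have "\<dots> = c * x (inv a \<otimes> g)"
    using a finite_carrier by simp
  finally show ?thesis .
qed

lemma ga_single_one_conv:
  assumes x: "x \<in> carrier (group_algebra G)"
  shows "ga_single \<one> c \<star> x = (\<lambda>g. c * x g)"
proof
  fix g show "(ga_single \<one> c \<star> x) g = c * x g"
    using ga_single_conv[OF one_closed x] x
    by (cases "g \<in> carrier G") (auto simp: group_algebra_outside[OF conv_closed] group_algebra_outside)
qed

text \<open>Both sides are the sum of \<open>x h * y (inv h)\<close>: the coefficient at
  \<open>\<one>\<close> is a trace form.\<close>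

lemma conv_at_one_commute:
  assumes "x \<in> carrier (group_algebra G)" "y \<in> carrier (group_algebra G)"
  shows "(x \<star> y) \<one> = (y \<star> x) \<one>"
  using assms by (simp add: conv_apply[of x] conv_apply'[of y] mult.commute)

lemma conv_as_sum:
  assumes x: "x \<in> carrier (group_algebra G)" and y: "y \<in> carrier (group_algebra G)"
  shows "x \<star> y = (\<lambda>g. \<Sum>h\<in>carrier G. x h * (ga_single h 1 \<star> y) g)"
proof
  fix g show "(x \<star> y) g = (\<Sum>h\<in>carrier G. x h * (ga_single h 1 \<star> y) g)"
    using assms
    by (cases "g \<in> carrier G") (auto simp: conv_apply[OF x y] ga_single_conv
        group_algebra_outside[OF conv_closed])
qed

text \<open>Composing with \<open>\<tau>\<close> reverses a convolution, so
  \<open>x \<star> y\<close>, being invariant itself, equals \<open>y \<star> x\<close>. Invariance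
  of the product is a hypothesis of its own because it does not follow from that of the
  factors.\<close>

lemma conv_commute_of_anti_involution:
  assumes \<tau>: "\<And>g. g \<in> carrier G \<Longrightarrow> \<tau> g \<in> carrier G"
    and \<tau>\<tau>: "\<And>g. g \<in> carrier G \<Longrightarrow> \<tau> (\<tau> g) = g"
    and \<tau>_mult: "\<And>g h. g \<in> carrier G \<Longrightarrow> h \<in> carrier G \<Longrightarrow> \<tau> (g \<otimes> h) = \<tau> h \<otimes> \<tau> g"
    and x: "x \<in> carrier (group_algebra G)" "\<And>g. g \<in> carrier G \<Longrightarrow> x (\<tau> g) = x g"
    and y: "y \<in> carrier (group_algebra G)" "\<And>g. g \<in> carrier G \<Longrightarrow> y (\<tau> g) = y g"
    and xy: "\<And>g. g \<in> carrier G \<Longrightarrow> (x \<star> y) (\<tau> g) = (x \<star> y) g"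
  shows "x \<star> y = y \<star> x"
proof
  fix g
  show "(x \<star> y) g = (y \<star> x) g"
  proof (cases "g \<in> carrier G")
    case g: True
    have \<tau>_one: "\<tau> \<one> = \<one>"
      using \<tau>_mult[of \<one> \<one>] \<tau>[of \<one>] by simp
    have \<tau>_inv: "\<tau> (inv h) = inv (\<tau> h)" if "h \<in> carrier G" for h
      using \<tau>_mult[of h "inv h"] \<tau>[of h] \<tau>[of "inv h"] that \<tau>_one by (intro inv_equality[symmetric]) simp_all
    have bij: "bij_betw \<tau> (carrier G) (carrier G)"
      by (rule bij_betw_byWitness[where f' = \<tau>]) (auto simp: \<tau> \<tau>\<tau>)
    have "(x \<star> y) g = (x \<star> y) (\<tau> g)" using xy[OF g] by simp
    also have "\<dots> = (\<Sum>h\<in>carrier G. x h * y (inv h \<otimes> \<tau> g))"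
      using \<tau>[OF g] by (simp add: conv_apply x y)
    also have "\<dots> = (\<Sum>h\<in>carrier G. x (\<tau> h) * y (inv (\<tau> h) \<otimes> \<tau> g))"
      by (rule sum.reindex_bij_betw[OF bij, symmetric])
    also have "\<dots> = (\<Sum>h\<in>carrier G. y (g \<otimes> inv h) * x h)"
    proof (rule sum.cong[OF refl])
      fix h assume h: "h \<in> carrier G"
      have "inv (\<tau> h) \<otimes> \<tau> g = \<tau> (g \<otimes> inv h)" using h g by (simp add: \<tau>_mult \<tau>_inv)
      then show "x (\<tau> h) * y (inv (\<tau> h) \<otimes> \<tau> g) = y (g \<otimes> inv h) * x h"
        using h g by (simp add: x(2) y(2) mult.commute)
    qed
    also have "\<dots> = (y \<star> x) g" using g by (simp add: conv_apply' x y)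
    finally show ?thesis .
  qed (simp add: group_algebra_outside[OF conv_closed] x(1) y(1))
qed

end

section \<open>The idempotent of a character of a subgroup, and its Hecke algebra\<close>

locale finite_group_character = finite_group +
  fixes U :: "'a set" and \<eta> :: "'a \<Rightarrow> 'f :: field"
  assumes subgroup_U: "subgroup U G"
    and \<eta>_one: "\<eta> \<one> = 1"
    and \<eta>_mult: "u \<in> U \<Longrightarrow> v \<in> U \<Longrightarrow> \<eta> (u \<otimes> v) = \<eta> u * \<eta> v"
    and card_U: "of_nat (card U) \<noteq> (0 :: 'f)"
begin

sublocale U: subgroup U G by (rule subgroup_U)

lemma finite_U: "finite U"
  using finite_subset[OF U.subset finite_carrier] .

lemma \<eta>_inv: "u \<in> U \<Longrightarrow> \<eta> u * \<eta> (inv u) = 1"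
  using \<eta>_mult[of u "inv u"] \<eta>_one by simp

text \<open>The coefficients are those of the inverse character. This makes \<open>u\<close> act on
  \<open>\<e>\<close> by \<open>\<eta> u\<close> itself, which is the rule by which \<open>u\<close>
  crosses the tensor sign.\<close>

definition char_idem :: "'a \<Rightarrow> 'f" ("\<e>")
  where "\<e> g = (if g \<in> U then \<eta> (inv g) / of_nat (card U) else 0)"

lemma char_idem_closed [simp]: "\<e> \<in> carrier (group_algebra G)"
  using U.subset by (auto simp: carrier_group_algebra_iff char_idem_def)

abbreviation "U_algebra \<equiv> group_algebra (G\<lparr>carrier := U\<rparr>)"

lemma carrier_U_algebra_iff:
  "r \<in> carrier U_algebra \<longleftrightarrow> (\<forall>g. g \<notin> U \<longrightarrow> r g = 0)"
  unfolding group_algebra_def using finite_subset[OF _ finite_U, of "{g. r g \<noteq> 0}"] by auto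

lemma U_algebra_subset:
  "r \<in> carrier U_algebra \<Longrightarrow> r \<in> carrier (group_algebra G)"
  using U.subset by (auto simp: carrier_group_algebra_iff carrier_U_algebra_iff)

lemma char_idem_in_U_algebra: "\<e> \<in> carrier U_algebra"
  by (simp add: carrier_U_algebra_iff char_idem_def)

lemma char_lact_eq:
  assumes "r \<in> carrier U_algebra"
  shows "char_lact \<eta> r c = (\<Sum>u\<in>U. r u * \<eta> u) * c"
proof -
  have "(\<Sum>u | r u \<noteq> 0. r u * \<eta> u) = (\<Sum>u\<in>U. r u * \<eta> u)"
    using assms finite_U by (intro sum.mono_neutral_left) (auto simp: carrier_U_algebra_iff)
  then show ?thesis by (simp add: char_lact_def)
qed

lemma char_lact_idem: "char_lact \<eta> \<e> c = c"
proof -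
  have "(\<Sum>u\<in>U. \<e> u * \<eta> u) = (\<Sum>u\<in>U. 1 / of_nat (card U))"
    using \<eta>_inv by (intro sum.cong) (auto simp: char_idem_def mult.commute)
  also have "\<dots> = 1" using card_U by simp
  finally show ?thesis by (simp add: char_lact_eq[OF char_idem_in_U_algebra])
qed

text \<open>The multiples of \<open>\<e>\<close> form a copy of the one-dimensional module
  \<open>\<eta>\<close> over the group algebra of \<open>U\<close>. This is what makes the map from
  the tensor product to F[G]e balanced.\<close>

lemma conv_char_idem:
  assumes r: "r \<in> carrier U_algebra"
  shows "r \<star> \<e> = (\<lambda>g. char_lact \<eta> r 1 * \<e> g)"
proof
  fix g
  show "(r \<star> \<e>) g = char_lact \<eta> r 1 * \<e> g"
  proof (cases "g \<in> carrier G")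
    case g: True
    have "(r \<star> \<e>) g = (\<Sum>h\<in>carrier G. r h * \<e> (inv h \<otimes> g))"
      using g by (simp add: conv_apply U_algebra_subset[OF r])
    also have "\<dots> = (\<Sum>h\<in>U. r h * \<e> (inv h \<otimes> g))"
      using r U.subset finite_carrier
      by (intro sum.mono_neutral_right) (auto simp: carrier_U_algebra_iff)
    also have "\<dots> = (\<Sum>h\<in>U. r h * \<eta> h * \<e> g)"
    proof (rule sum.cong[OF refl])
      fix h assume h: "h \<in> U"
      then have hG: "h \<in> carrier G" by simp
      show "r h * \<e> (inv h \<otimes> g) = r h * \<eta> h * \<e> g"
      proof (cases "g \<in> U")
        case True
        then have "\<eta> (inv (inv h \<otimes> g)) = \<eta> (inv g) * \<eta> h"
          using h hG g by (simp add: inv_mult_group \<eta>_mult)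
        then show ?thesis using True h by (simp add: char_idem_def)
      next
        case False
        have "g = h \<otimes> (inv h \<otimes> g)" using hG g by (simp add: m_assoc[symmetric])
        then have "inv h \<otimes> g \<notin> U" using False h U.m_closed by metis
        then show ?thesis using False by (simp add: char_idem_def)
      qed
    qed
    also have "\<dots> = char_lact \<eta> r 1 * \<e> g"
      by (simp add: char_lact_eq[OF r] sum_distrib_right)
    finally show ?thesis .
  next
    case False
    then show ?thesis
      using U_algebra_subset[OF r] by (simp add: group_algebra_outside[OF conv_closed] group_algebra_outside)
  qed
qed

lemma char_idem_idem: "\<e> \<star> \<e> = \<e>"
  by (simp add: conv_char_idem[OF char_idem_in_U_algebra] char_lact_idem)

lemma char_idem_mult:
  assumes k: "k \<in> carrier G" and u: "u \<in> U"
  shows "\<e> (k \<otimes> u) * \<eta> u = \<e> k" "\<e> (u \<otimes> k) * \<eta> u = \<e> k"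
proof -
  have uG: "u \<in> carrier G" using u by simp
  have "k \<in> U" if "k \<otimes> u \<in> U"
    using U.m_closed[OF that U.m_inv_closed[OF u]] k uG by (simp add: m_assoc)
  then have "k \<otimes> u \<in> U \<longleftrightarrow> k \<in> U" using U.m_closed[OF _ u] by blast
  moreover have "k \<in> U" if "u \<otimes> k \<in> U"
    using U.m_closed[OF U.m_inv_closed[OF u] that] k uG by (simp add: m_assoc[symmetric])
  then have "u \<otimes> k \<in> U \<longleftrightarrow> k \<in> U" using U.m_closed[OF u] by blast
  moreover have "\<eta> (inv (k \<otimes> u)) * \<eta> u = \<eta> (inv k)" "\<eta> (inv (u \<otimes> k)) * \<eta> u = \<eta> (inv k)"
    if "k \<in> U"
    using that u \<eta>_inv[OF u] by (simp_all add: inv_mult_group \<eta>_mult mult_ac)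
  ultimately show "\<e> (k \<otimes> u) * \<eta> u = \<e> k" "\<e> (u \<otimes> k) * \<eta> u = \<e> k"
    by (simp_all add: char_idem_def)
qed

text \<open>Inherited from the translates of \<open>\<e>\<close>. Under right translation
  \<open>x\<close> transforms by the inverse of \<open>\<eta> u\<close>; keeping
  \<open>\<eta> u\<close> on the left-hand side avoids writing that inverse.\<close>

lemma equivariant_right:
  assumes x: "x \<in> carrier (group_algebra G)" "x \<star> \<e> = x" and g: "g \<in> carrier G" and u: "u \<in> U"
  shows "x (g \<otimes> u) * \<eta> u = x g"
proof -
  have uG: "u \<in> carrier G" using u by simp
  have "(x \<star> \<e>) (g \<otimes> u) * \<eta> u = (\<Sum>h\<in>carrier G. x h * (\<e> (inv h \<otimes> g \<otimes> u) * \<eta> u))"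
    using g uG x(1) by (simp add: conv_apply sum_distrib_right m_assoc mult.assoc)
  also have "\<dots> = (x \<star> \<e>) g"
    using g x(1) u by (simp add: conv_apply char_idem_mult)
  finally show ?thesis by (simp add: x(2))
qed

lemma equivariant_left:
  assumes x: "x \<in> carrier (group_algebra G)" "\<e> \<star> x = x" and g: "g \<in> carrier G" and u: "u \<in> U"
  shows "x (u \<otimes> g) * \<eta> u = x g"
proof -
  have uG: "u \<in> carrier G" using u by simp
  have "(\<e> \<star> x) (u \<otimes> g) * \<eta> u = (\<Sum>h\<in>carrier G. (\<e> (u \<otimes> (g \<otimes> inv h)) * \<eta> u) * x h)"
    using g uG x(1) by (simp add: conv_apply' sum_distrib_left m_assoc mult_ac)
  also have "\<dots> = (\<e> \<star> x) g"
    using g x(1) u by (simp add: conv_apply' char_idem_mult)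
  finally show ?thesis by (simp add: x(2))
qed

text \<open>The product of two elements of the Hecke algebra lies in it again. As
  \<open>invariant\<close> is demanded of every function equivariant on both sides, it covers
  \<open>x\<close>, \<open>y\<close> and \<open>x \<star> y\<close> alike.\<close>

lemma hecke_commute_of_anti_involution:
  assumes \<tau>: "\<And>g. g \<in> carrier G \<Longrightarrow> \<tau> g \<in> carrier G"
    and \<tau>\<tau>: "\<And>g. g \<in> carrier G \<Longrightarrow> \<tau> (\<tau> g) = g"
    and \<tau>_mult: "\<And>g h. g \<in> carrier G \<Longrightarrow> h \<in> carrier G \<Longrightarrow> \<tau> (g \<otimes> h) = \<tau> h \<otimes> \<tau> g"
    and invariant: "\<And>x g. \<lbrakk>\<And>g u. g \<in> carrier G \<Longrightarrow> u \<in> U \<Longrightarrow> x (u \<otimes> g) * \<eta> u = x g;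
      \<And>g u. g \<in> carrier G \<Longrightarrow> u \<in> U \<Longrightarrow> x (g \<otimes> u) * \<eta> u = x g; g \<in> carrier G\<rbrakk> \<Longrightarrow> x (\<tau> g) = x g"
    and x: "x \<in> carrier (group_algebra G)" "x \<star> \<e> = x" "\<e> \<star> x = x"
    and y: "y \<in> carrier (group_algebra G)" "y \<star> \<e> = y" "\<e> \<star> y = y"
  shows "x \<star> y = y \<star> x"
proof -
  have inv: "x (\<tau> g) = x g"
    if x: "x \<in> carrier (group_algebra G)" "x \<star> \<e> = x" "\<e> \<star> x = x" and g: "g \<in> carrier G" for x g
    using equivariant_left[OF x(1,3)] equivariant_right[OF x(1,2)] g by (rule invariant)
  have xy: "x \<star> y \<in> carrier (group_algebra G)" "x \<star> y \<star> \<e> = x \<star> y" "\<e> \<star> (x \<star> y) = x \<star> y"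
    using x y by (simp, simp add: conv_assoc, simp add: conv_assoc[symmetric])
  show "x \<star> y = y \<star> x"
    using \<tau> \<tau>\<tau> \<tau>_mult x(1) inv[OF x] y(1) inv[OF y] inv[OF xy]
    by (rule conv_commute_of_anti_involution)
qed

end

section \<open>Minimal left ideals over a commutative Hecke algebra\<close>

text \<open>Gaussian elimination, one coordinate at a time: a vector \<open>f j\<close> with nonzero
  \<open>t\<close>-coordinate clears that coordinate from all the others, which leaves one vector
  and one coordinate less.\<close>

lemma linear_relation:
  fixes f :: "'i \<Rightarrow> 's \<Rightarrow> 'f :: field"
  assumes "finite S" "finite I" "card S < card I"
  shows "\<exists>c. (\<exists>i\<in>I. c i \<noteq> 0) \<and> (\<forall>s\<in>S. (\<Sum>i\<in>I. c i * f i s) = 0)"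
  using assms
proof (induction S arbitrary: I f rule: finite_induct)
  case empty
  then obtain i where "i \<in> I" by fastforce
  then show ?case by (intro exI[of _ "\<lambda>_. 1"]) auto
next
  case (insert t S)
  show ?case
  proof (cases "\<exists>j\<in>I. f j t \<noteq> 0")
    case False
    obtain c where "\<exists>i\<in>I. c i \<noteq> 0" "\<forall>s\<in>S. (\<Sum>i\<in>I. c i * f i s) = 0"
      using insert.IH[of I f] insert.prems insert.hyps by auto
    with False show ?thesis by (intro exI[of _ c]) auto
  next
    case True
    then obtain j where j: "j \<in> I" "f j t \<noteq> 0" by auto
    define g where "g i s = f i s - f i t / f j t * f j s" for i s
    have "card S < card (I - {j})" using insert.prems insert.hyps j by simp
    then obtain c where c: "\<exists>i\<in>I - {j}. c i \<noteq> 0" "\<forall>s\<in>S. (\<Sum>i\<in>I - {j}. c i * g i s) = 0"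
      using insert.IH[of "I - {j}" g] insert.prems by auto
    \<comment> \<open>The coefficient at \<open>j\<close> collects the multiples of
      \<open>f j\<close> hidden in the vectors \<open>g i\<close>, so that the two linear
      combinations agree.\<close>
    define d where "d = c(j := - (\<Sum>i\<in>I - {j}. c i * (f i t / f j t)))"
    have sum: "(\<Sum>i\<in>I. d i * f i s) = (\<Sum>i\<in>I - {j}. c i * g i s)" for s
    proof -
      have "(\<Sum>i\<in>I. d i * f i s) = d j * f j s + (\<Sum>i\<in>I - {j}. d i * f i s)"
        using insert.prems j by (simp add: sum.remove)
      also have "(\<Sum>i\<in>I - {j}. d i * f i s) = (\<Sum>i\<in>I - {j}. c i * f i s)"
        by (intro sum.cong) (auto simp: d_def)
      also have "d j * f j s = (\<Sum>i\<in>I - {j}. - (c i * (f i t / f j t) * f j s))"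
        by (simp add: d_def sum_distrib_right sum_negf)
      finally show ?thesis
        by (simp add: sum.distrib[symmetric] g_def algebra_simps)
    qed
    have "(\<Sum>i\<in>I - {j}. c i * g i t) = 0" using j by (simp add: g_def)
    moreover have "\<exists>i\<in>I. d i \<noteq> 0" using c(1) by (auto simp: d_def)
    ultimately show ?thesis using c(2) by (intro exI[of _ d]) (auto simp: sum)
  qed
qed

text \<open>Among all pairs of a nonzero polynomial and a nonzero function annihilated by it, one of
  least degree is linear.\<close>

lemma eigenfunction_exists:
  fixes J :: "('s \<Rightarrow> 'f :: alg_closed_field) set"
  assumes S: "finite S" "\<And>x s. x \<in> J \<Longrightarrow> s \<notin> S \<Longrightarrow> x s = 0"
    and J_add: "\<And>x y. x \<in> J \<Longrightarrow> y \<in> J \<Longrightarrow> (\<lambda>s. x s + y s) \<in> J"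
    and J_scale: "\<And>x c. x \<in> J \<Longrightarrow> (\<lambda>s. c * x s) \<in> J"
    and M: "\<And>x. x \<in> J \<Longrightarrow> M x \<in> J"
    and M_add: "\<And>x y. x \<in> J \<Longrightarrow> y \<in> J \<Longrightarrow> M (\<lambda>s. x s + y s) = (\<lambda>s. M x s + M y s)"
    and M_scale: "\<And>x c. x \<in> J \<Longrightarrow> M (\<lambda>s. c * x s) = (\<lambda>s. c * M x s)"
    and y: "y \<in> J" "y \<noteq> (\<lambda>_. 0)"
  obtains x c where "x \<in> J" "x \<noteq> (\<lambda>_. 0)" "M x = (\<lambda>s. c * x s)"
proof -
  \<comment> \<open>\<open>ev p x\<close> is \<open>p(M) x\<close>, computed by Horner's
    scheme.\<close>
  define ev where "ev p x = fold_coeffs (\<lambda>a y s. a * x s + M y s) p (\<lambda>_. 0)" for p x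
  have M_0: "M (\<lambda>_. 0) = (\<lambda>_. 0)" using M_scale[OF y(1), of 0] by simp
  have ev_0 [simp]: "ev 0 x = (\<lambda>_. 0)" for x by (simp add: ev_def)
  have ev_pCons [simp]: "ev (pCons a p) x = (\<lambda>s. a * x s + M (ev p x) s)" for a p x
    by (cases "p = 0 \<and> a = 0") (auto simp: ev_def M_0)
  have J_0: "(\<lambda>_. 0) \<in> J" using J_scale[OF y(1), of 0] by simp
  have ev_J: "ev p x \<in> J" if "x \<in> J" for p x
    by (induction p) (use that in \<open>auto simp: J_0 intro!: J_add J_scale M\<close>)
  have ev_add: "ev (p + q) x = (\<lambda>s. ev p x s + ev q x s)" if x: "x \<in> J" for p q x
  proof (induction p q rule: poly_induct2)
    case (pCons a p b q)
    then show ?case by (simp add: M_add ev_J x algebra_simps)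
  qed simp
  have ev_smult: "ev (Polynomial.smult c p) x = (\<lambda>s. c * ev p x s)" if x: "x \<in> J" for p c x
  proof (induction p)
    case (pCons a p)
    then show ?case by (simp add: M_scale ev_J x algebra_simps)
  qed simp
  have ev_sum: "ev (\<Sum>i\<in>I. Polynomial.smult (c i) (p i)) x = (\<lambda>s. \<Sum>i\<in>I. c i * ev (p i) x s)"
    if x: "x \<in> J" "finite I" for I :: "nat set" and c p x
    using that(2) by (induction I rule: finite_induct) (auto simp: ev_add ev_smult x)
  define P where "P n \<longleftrightarrow> (\<exists>p x. x \<in> J \<and> x \<noteq> (\<lambda>_. 0) \<and> p \<noteq> 0 \<and> ev p x = (\<lambda>_. 0) \<and> degree p = n)" for n
  have "\<exists>n. P n"
  proof -
    \<comment> \<open>The \<open>card S + 1\<close> vectors obtained from \<open>y\<close> by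
      applying powers of \<open>M\<close> have only \<open>card S\<close> coordinates. A linear
      relation between them is a nonzero polynomial that annihilates \<open>y\<close>.\<close>
    obtain c where c: "\<exists>i\<in>{..card S}. c i \<noteq> 0"
      "\<forall>s\<in>S. (\<Sum>i\<le>card S. c i * ev (monom 1 i) y s) = 0"
      using linear_relation[of S "{..card S}" "\<lambda>i s. ev (monom 1 i) y s"] S by auto
    define p where "p = (\<Sum>i\<le>card S. Polynomial.smult (c i) (monom 1 i))"
    obtain i where i: "i \<le> card S" "c i \<noteq> 0" using c(1) by auto
    have "coeff p i = c i" using i(1) by (simp add: p_def coeff_sum if_distrib cong: if_cong)
    then have "p \<noteq> 0" using i(2) by auto
    moreover have "ev p y = (\<lambda>_. 0)"
    proof
      fix s show "ev p y s = 0"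
      proof (cases "s \<in> S")
        case True
        then show ?thesis using c(2) by (simp add: p_def ev_sum[OF y(1)])
      next
        case False
        then show ?thesis using S(2)[OF ev_J[OF y(1)]] by blast
      qed
    qed
    ultimately show ?thesis unfolding P_def using y by blast
  qed
  then obtain n where n: "P n" "\<And>m. m < n \<Longrightarrow> \<not> P m"
    by (metis exists_least_iff)
  then obtain p x where p: "x \<in> J" "x \<noteq> (\<lambda>_. 0)" "p \<noteq> 0" "ev p x = (\<lambda>_. 0)" "degree p = n"
    unfolding P_def by blast
  have "degree p \<noteq> 0"
  proof
    assume "degree p = 0"
    then obtain a where a: "p = [:a:]" by (rule degree_eq_zeroE)
    then have "a * x s = 0" for s using fun_cong[OF p(4), of s] by (simp add: M_0)
    moreover obtain t where "x t \<noteq> 0" using p(2) by auto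
    ultimately show False using p(3) a by auto
  qed
  then obtain c where "poly p c = 0" using alg_closed_imp_poly_has_root[of p] by auto
  then obtain q where q: "p = [:- c, 1:] * q" by (metis poly_eq_0_iff_dvd dvdE)
  then have q0: "q \<noteq> 0" using p(3) by auto
  have "degree p = Suc (degree q)"
    unfolding q by (subst degree_mult_eq) (use q0 in auto)
  \<comment> \<open>Minimality of \<open>n\<close> keeps \<open>q(M) x\<close> from vanishing. As
    \<open>p = (X - c) q\<close> annihilates \<open>x\<close>, this vector is the
    eigenfunction.\<close>
  then have "ev q x \<noteq> (\<lambda>_. 0)"
    using n(2)[of "degree q"] p q0 unfolding P_def by auto
  moreover have "M (ev q x) = (\<lambda>s. c * ev q x s)"
  proof -
    have "p = Polynomial.smult (- c) q + pCons 0 q" unfolding q by simp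
    then have "(\<lambda>s. - c * ev q x s + M (ev q x) s) = (\<lambda>_. 0)"
      using p(4) ev_add[OF p(1), of "Polynomial.smult (- c) q" "pCons 0 q"] ev_smult[OF p(1), of "- c" q]
      by simp
    then show ?thesis by (simp add: fun_eq_iff)
  qed
  ultimately show ?thesis using that ev_J[OF p(1)] by blast
qed

section \<open>Left ideals of the group algebra and maps out of them\<close>

context finite_group
begin

definition left_ideal :: "('a \<Rightarrow> 'f :: field) set \<Rightarrow> bool"
  where "left_ideal A \<longleftrightarrow> A \<subseteq> carrier (group_algebra G) \<and> (\<lambda>_. 0) \<in> A \<and>
    (\<forall>x\<in>A. \<forall>y\<in>A. (\<lambda>g. x g + y g) \<in> A) \<and> (\<forall>x\<in>A. \<forall>c. (\<lambda>g. c * x g) \<in> A) \<and>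
    (\<forall>x\<in>A. \<forall>a\<in>carrier G. ga_single a 1 \<star> x \<in> A)"

lemma left_idealD:
  assumes "left_ideal A"
  shows "x \<in> A \<Longrightarrow> x \<in> carrier (group_algebra G)" "(\<lambda>_. 0) \<in> A"
    "x \<in> A \<Longrightarrow> y \<in> A \<Longrightarrow> (\<lambda>g. x g + y g) \<in> A"
    "x \<in> A \<Longrightarrow> (\<lambda>g. c * x g) \<in> A"
    "x \<in> A \<Longrightarrow> a \<in> carrier G \<Longrightarrow> ga_single a 1 \<star> x \<in> A"
  using assms by (auto simp: left_ideal_def)

text \<open>Stability and equivariance are given for group elements only, and \<open>a\<close> is a
  linear combination of these. The two claims are proved together because \<open>s\<close> is
  additive only on \<open>A\<close>, so each partial sum must be known to lie there.\<close>

lemma left_ideal_conv_hom: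
  fixes A :: "('a \<Rightarrow> 'f :: field) set"
  assumes A: "left_ideal A" and s: "\<And>x. x \<in> A \<Longrightarrow> s x \<in> carrier (group_algebra G)"
    and s_add: "\<And>x y. x \<in> A \<Longrightarrow> y \<in> A \<Longrightarrow> s (\<lambda>g. x g + y g) = (\<lambda>g. s x g + s y g)"
    and s_scale: "\<And>x c. x \<in> A \<Longrightarrow> s (\<lambda>g. c * x g) = (\<lambda>g. c * s x g)"
    and s_single: "\<And>x a. x \<in> A \<Longrightarrow> a \<in> carrier G \<Longrightarrow> s (ga_single a 1 \<star> x) = ga_single a 1 \<star> s x"
    and a: "a \<in> carrier (group_algebra G)" and x: "x \<in> A"
  shows "a \<star> x \<in> A \<and> s (a \<star> x) = a \<star> s x"
proof -
  have "(\<lambda>g. \<Sum>h\<in>H. a h * (ga_single h 1 \<star> x) g) \<in> A \<and>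
      s (\<lambda>g. \<Sum>h\<in>H. a h * (ga_single h 1 \<star> x) g) = (\<lambda>g. \<Sum>h\<in>H. a h * (ga_single h 1 \<star> s x) g)"
    if "finite H" "H \<subseteq> carrier G" for H
    using that
  proof (induction H rule: finite_induct)
    case empty
    then show ?case using left_idealD(2)[OF A] s_scale[OF x, of 0] s_scale[of "\<lambda>_. 0" 0] by simp
  next
    case (insert h H)
    have h: "ga_single h 1 \<star> x \<in> A" using insert.prems by (intro left_idealD(5)[OF A x]) simp
    then have "(\<lambda>g. a h * (ga_single h 1 \<star> x) g) \<in> A" by (rule left_idealD(4)[OF A])
    with insert h show ?case
      using left_idealD(3)[OF A] s_add s_scale[OF h] s_single[OF x] by simp
  qed
  from this[OF finite_carrier subset_refl] show ?thesis
    using conv_as_sum[OF a left_idealD(1)[OF A x]] conv_as_sum[OF a s[OF x]] by simp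
qed

lemma left_ideal_conv_image:
  fixes x :: "'a \<Rightarrow> 'f :: field"
  assumes x: "x \<in> carrier (group_algebra G)"
  shows "left_ideal ((\<lambda>a. a \<star> x) ` carrier (group_algebra G))"
  unfolding left_ideal_def
proof (intro conjI ballI allI)
  show "(\<lambda>_. 0) \<in> (\<lambda>a. a \<star> x) ` carrier (group_algebra G)"
    using x by (intro image_eqI[of _ _ "\<lambda>_. 0"]) auto
next
  fix y z c b
  assume "y \<in> (\<lambda>a. a \<star> x) ` carrier (group_algebra G)"
  then obtain a where a: "a \<in> carrier (group_algebra G)" "y = a \<star> x" by blast
  show "(\<lambda>g. c * y g) \<in> (\<lambda>a. a \<star> x) ` carrier (group_algebra G)"
    unfolding a(2) conv_scale_left[OF a(1) x, symmetric] using a(1) by simp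
  show "ga_single b 1 \<star> y \<in> (\<lambda>a. a \<star> x) ` carrier (group_algebra G)" if b: "b \<in> carrier G"
    unfolding a(2) conv_assoc[OF ga_single_closed[OF b] a(1) x, symmetric] using a(1) b by simp
  assume "z \<in> (\<lambda>a. a \<star> x) ` carrier (group_algebra G)"
  then obtain b where b: "b \<in> carrier (group_algebra G)" "z = b \<star> x" by blast
  show "(\<lambda>g. y g + z g) \<in> (\<lambda>a. a \<star> x) ` carrier (group_algebra G)"
    unfolding a(2) b(2) conv_add_left[OF a(1) b(1) x, symmetric] using a(1) b(1) by simp
qed (use x in auto)

end

locale commutative_hecke_algebra = finite_group_character G U \<eta>
  for G (structure) and U and \<eta> :: "'a \<Rightarrow> 'f :: alg_closed_field" +
  assumes hecke_commute:
    "\<lbrakk>x \<in> carrier (group_algebra G); x \<star> \<e> = x; \<e> \<star> x = x;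
      y \<in> carrier (group_algebra G); y \<star> \<e> = y; \<e> \<star> y = y\<rbrakk> \<Longrightarrow> x \<star> y = y \<star> x"
begin

text \<open>For \<open>x\<close> in \<open>A\<close>, the value of \<open>s x\<close> at
  \<open>\<one>\<close> equals that of \<open>\<e> \<star> s x = s (\<e> \<star> x)\<close>. Since
  \<open>\<e> \<star> x\<close> lies on a fixed line, this is a fixed multiple of
  \<open>x \<one>\<close>. Applied to all translates of \<open>x\<close>, the identity at
  \<open>\<one>\<close> becomes an identity of functions.\<close>

theorem minimal_left_ideal_hom:
  assumes A: "left_ideal A" and Ae: "\<And>x. x \<in> A \<Longrightarrow> x \<star> \<e> = x"
    and minimal: "\<And>W. left_ideal W \<Longrightarrow> W \<subseteq> A \<Longrightarrow> W = {\<lambda>_. 0} \<or> W = A"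
    and s: "\<And>x. x \<in> A \<Longrightarrow> s x \<in> carrier (group_algebra G)"
    and se: "\<And>x. x \<in> A \<Longrightarrow> s x \<star> \<e> = s x"
    and s_add: "\<And>x y. x \<in> A \<Longrightarrow> y \<in> A \<Longrightarrow> s (\<lambda>g. x g + y g) = (\<lambda>g. s x g + s y g)"
    and s_scale: "\<And>x c. x \<in> A \<Longrightarrow> s (\<lambda>g. c * x g) = (\<lambda>g. c * s x g)"
    and s_single: "\<And>x a. x \<in> A \<Longrightarrow> a \<in> carrier G \<Longrightarrow> s (ga_single a 1 \<star> x) = ga_single a 1 \<star> s x"
  obtains c where "\<And>x. x \<in> A \<Longrightarrow> s x = (\<lambda>g. c * x g)"
proof (cases "A = {\<lambda>_. 0}")
  case True
  have "s (\<lambda>_. 0) = (\<lambda>_. 0)" using s_scale[of "\<lambda>_. 0" 0] True by simp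
  then show ?thesis using that[of 0] True by simp
next
  case False
  note AD = left_idealD[OF A]
  have conv: "a \<star> x \<in> A \<and> s (a \<star> x) = a \<star> s x"
    if "a \<in> carrier (group_algebra G)" "x \<in> A" for a x
    using A s s_add s_scale s_single that by (rule left_ideal_conv_hom)
  have conv_A: "a \<star> x \<in> A" if "a \<in> carrier (group_algebra G)" "x \<in> A" for a x
    using conv[OF that] by (rule conjunct1)
  have s_conv: "s (a \<star> x) = a \<star> s x" if "a \<in> carrier (group_algebra G)" "x \<in> A" for a x
    using conv[OF that] by (rule conjunct2)
  have trace: "(\<e> \<star> x) \<one> = x \<one>" if "x \<in> carrier (group_algebra G)" "x \<star> \<e> = x" for x
    using conv_at_one_commute[OF char_idem_closed that(1)] that(2) by simp
  define J where "J = {x \<in> A. \<e> \<star> x = x}"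
  have eJ: "\<e> \<star> x \<in> J" if "x \<in> A" for x
    using that AD(1)[OF that] conv_A
    by (simp add: J_def conv_assoc[symmetric] char_idem_idem)
  \<comment> \<open>No nonzero left ideal lies in the kernel of evaluation at \<open>\<one>\<close>.
    Hence \<open>A\<close> contains some \<open>y\<close> with \<open>y \<one> \<noteq> 0\<close>,
    and by \<open>trace\<close> the element \<open>\<e> \<star> y\<close> is nonzero as
    well.\<close>
  have shift: "\<exists>a\<in>carrier G. (ga_single a 1 \<star> x) \<one> \<noteq> 0"
    if x: "x \<in> carrier (group_algebra G)" "x \<noteq> (\<lambda>_. 0)" for x :: "'a \<Rightarrow> 'f"
  proof -
    obtain g where g: "x g \<noteq> 0" using x(2) by auto
    then have gG: "g \<in> carrier G" using x(1) by (auto simp: carrier_group_algebra_iff)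
    then have "(ga_single (inv g) 1 \<star> x) \<one> = x g"
      using ga_single_conv[OF inv_closed x(1) one_closed] by simp
    with g gG show ?thesis by (intro bexI[of _ "inv g"]) auto
  qed
  obtain y where y: "y \<in> A" "y \<one> \<noteq> 0"
  proof -
    obtain x where "x \<in> A" "x \<noteq> (\<lambda>_. 0)" using False AD(2) by auto
    then show ?thesis using shift[of x] AD(1,5) that by blast
  qed
  define w where "w = \<e> \<star> y"
  have w: "w \<in> J" "w \<one> \<noteq> 0"
    using eJ[OF y(1)] trace[OF AD(1)[OF y(1)] Ae[OF y(1)]] y(2) by (auto simp: w_def)
  have JA: "x \<in> A" "\<e> \<star> x = x" "x \<in> carrier (group_algebra G)" "x \<star> \<e> = x" if "x \<in> J" for x
    using that AD(1) Ae by (auto simp: J_def)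
  have J_add: "(\<lambda>g. x g + y g) \<in> J" if "x \<in> J" "y \<in> J" for x y
    using JA[OF that(1)] JA[OF that(2)] AD(3) by (simp add: J_def conv_add_right)
  have J_scale: "(\<lambda>g. c * x g) \<in> J" if "x \<in> J" for x c
    using JA[OF that] AD(4) by (simp add: J_def conv_scale_right)
  \<comment> \<open>Simplicity of \<open>J\<close> over the Hecke algebra. By minimality
    \<open>x\<close> generates \<open>A\<close> under the whole group algebra, and the multiplier
    can then be moved into the Hecke algebra.\<close>
  have generate: "\<exists>h. h \<in> carrier (group_algebra G) \<and> h \<star> \<e> = h \<and> \<e> \<star> h = h \<and> z = h \<star> x"
    if x: "x \<in> J" "x \<noteq> (\<lambda>_. 0)" and z: "z \<in> J" for x z
  proof -
    let ?W = "(\<lambda>a. a \<star> x) ` carrier (group_algebra G)"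
    have "?W \<subseteq> A" using conv_A JA[OF x(1)] by auto
    moreover have "x \<in> ?W" using JA[OF x(1)] by (intro image_eqI[of _ _ \<e>]) auto
    ultimately have "?W = A"
      using minimal[OF left_ideal_conv_image[OF JA(3)[OF x(1)]]] x(2) by auto
    then obtain a where a: "a \<in> carrier (group_algebra G)" "z = a \<star> x"
      using JA(1)[OF z] by auto
    \<comment> \<open>Since \<open>\<e>\<close> fixes both \<open>x\<close> and \<open>z\<close>
      from the left, \<open>a\<close> may be replaced by its compression by \<open>\<e>\<close> on
      both sides.\<close>
    have "\<e> \<star> (a \<star> \<e>) \<star> x = \<e> \<star> (a \<star> (\<e> \<star> x))"
      using a JA(3)[OF x(1)] by (simp add: conv_assoc)
    also have "\<dots> = z" using a JA(2)[OF x(1)] JA(2)[OF z] by simp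
    finally have "z = \<e> \<star> (a \<star> \<e>) \<star> x" ..
    moreover have "\<e> \<star> (a \<star> \<e>) \<star> \<e> = \<e> \<star> (a \<star> \<e>)" "\<e> \<star> (\<e> \<star> (a \<star> \<e>)) = \<e> \<star> (a \<star> \<e>)"
      using a by (simp_all add: conv_assoc char_idem_idem)
        (simp add: conv_assoc[symmetric] char_idem_idem)
    ultimately show ?thesis using a by (intro exI[of _ "\<e> \<star> (a \<star> \<e>)"]) simp
  qed
  have scalar: "\<exists>c. \<forall>x\<in>J. h \<star> x = (\<lambda>g. c * x g)"
    if h: "h \<in> carrier (group_algebra G)" "h \<star> \<e> = h" "\<e> \<star> h = h" for h
  proof -
    have hJ: "h \<star> x \<in> J" if "x \<in> J" for x
      using conv_A[OF h(1) JA(1)[OF that]] h JA[OF that]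
      by (simp add: J_def conv_assoc[symmetric])
    \<comment> \<open>Schur's lemma in concrete form: one eigenfunction of \<open>h\<close> exists
      in \<open>J\<close>. Every other element of \<open>J\<close> is \<open>k \<star> x\<close>
      with \<open>k\<close> commuting with \<open>h\<close>, so it has the same eigenvalue.\<close>
    obtain x c where x: "x \<in> J" "x \<noteq> (\<lambda>_. 0)" "h \<star> x = (\<lambda>g. c * x g)"
    proof (rule eigenfunction_exists[of "carrier G" J "\<lambda>x. h \<star> x" w])
      show "z g = 0" if "z \<in> J" "g \<notin> carrier G" for z g
        using group_algebra_outside[OF JA(3)] that by blast
      show "w \<noteq> (\<lambda>_. 0)" using w(2) by auto
    qed (use w finite_carrier J_add J_scale hJ JA h in
        \<open>simp_all add: conv_add_right conv_scale_right\<close>)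
    have "h \<star> z = (\<lambda>g. c * z g)" if z: "z \<in> J" for z
    proof -
      obtain k where k: "k \<in> carrier (group_algebra G)" "k \<star> \<e> = k" "\<e> \<star> k = k" "z = k \<star> x"
        using generate[OF x(1,2) z] by blast
      have "h \<star> z = k \<star> (h \<star> x)"
        using k h JA(3)[OF x(1)] hecke_commute[OF h k(1-3)] by (simp add: conv_assoc[symmetric])
      also have "\<dots> = (\<lambda>g. c * z g)"
        using k JA(3)[OF x(1)] by (simp add: x(3) conv_scale_right)
      finally show ?thesis .
    qed
    then show ?thesis by blast
  qed
  have line: "\<exists>c. z = (\<lambda>g. c * w g)" if "z \<in> J" for z
  proof -
    have "w \<noteq> (\<lambda>_. 0)" using w(2) by auto
    from generate[OF w(1) this that] obtain h
      where h: "h \<in> carrier (group_algebra G)" "h \<star> \<e> = h" "\<e> \<star> h = h" "z = h \<star> w"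
      by blast
    then show ?thesis using scalar[OF h(1-3)] w(1) by blast
  qed
  \<comment> \<open>The only possible scalar, read off at the generator \<open>w\<close> of the
    line.\<close>
  define c where "c = s w \<one> / w \<one>"
  have s_one: "s x \<one> = c * x \<one>" if x: "x \<in> A" for x
  proof -
    obtain a where a: "\<e> \<star> x = (\<lambda>g. a * w g)" using line[OF eJ[OF x]] by blast
    have "s x \<one> = (\<e> \<star> s x) \<one>" using trace[OF s[OF x] se[OF x]] by simp
    also have "\<e> \<star> s x = (\<lambda>g. a * s w g)"
      unfolding s_conv[OF char_idem_closed x, symmetric] a by (rule s_scale[OF JA(1)[OF w(1)]])
    also have "a * s w \<one> = c * (\<e> \<star> x) \<one>" using w(2) by (simp add: a c_def)
    also have "(\<e> \<star> x) \<one> = x \<one>" by (rule trace[OF AD(1)[OF x] Ae[OF x]])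
    finally show ?thesis .
  qed
  have "s x = (\<lambda>g. c * x g)" if x: "x \<in> A" for x
  proof
    fix g show "s x g = c * x g"
    proof (cases "g \<in> carrier G")
      case True
      have "s x g = s (ga_single (inv g) 1 \<star> x) \<one>"
        using True ga_single_conv[OF _ s[OF x], of "inv g" \<one> 1] s_single[OF x] by simp
      also have "\<dots> = c * (ga_single (inv g) 1 \<star> x) \<one>"
        using s_one[OF AD(5)[OF x]] True by simp
      also have "\<dots> = c * x g"
        using True ga_single_conv[OF _ AD(1)[OF x], of "inv g" \<one> 1] by simp
      finally show ?thesis .
    qed (simp add: group_algebra_outside[OF s[OF x]] group_algebra_outside[OF AD(1)[OF x]])
  qed
  then show ?thesis using that by blast
qed

end

section \<open>The induced representation as a left ideal\<close>

text \<open>The homomorphism that the universal property of the free abelian group attaches to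
  \<open>f\<close>.\<close>

definition frag_eval :: "('b \<Rightarrow> 'f :: ring_1) \<Rightarrow> ('b \<Rightarrow>\<^sub>0 int) \<Rightarrow> 'f"
  where "frag_eval f z = (\<Sum>k\<in>Poly_Mapping.keys z. of_int (Poly_Mapping.lookup z k) * f k)"

lemma frag_eval_superset:
  assumes "finite S" "Poly_Mapping.keys z \<subseteq> S"
  shows "frag_eval f z = (\<Sum>k\<in>S. of_int (Poly_Mapping.lookup z k) * f k)"
  unfolding frag_eval_def using assms
  by (intro sum.mono_neutral_left) (auto simp: in_keys_iff)

lemma frag_eval_0 [simp]: "frag_eval f 0 = 0"
  by (simp add: frag_eval_def)

lemma frag_eval_of [simp]: "frag_eval f (frag_of a) = f a"
  by (simp add: frag_eval_def)

lemma frag_eval_add: "frag_eval f (a + b) = frag_eval f a + frag_eval f b"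
proof -
  let ?S = "Poly_Mapping.keys a \<union> Poly_Mapping.keys b"
  show ?thesis
    using keys_add[of a b]
    by (subst (1 2 3) frag_eval_superset[of ?S])
      (auto simp: lookup_add distrib_right sum.distrib)
qed

lemma frag_eval_uminus: "frag_eval f (- a) = - frag_eval f a"
  using frag_eval_add[of f a "- a"] by (simp add: eq_neg_iff_add_eq_0 add.commute)

lemma frag_eval_diff: "frag_eval f (a - b) = frag_eval f a - frag_eval f b"
  using frag_eval_add[of f a "- b"] by (simp add: frag_eval_uminus)

context finite_group_character
begin

abbreviation "frag_group \<equiv>
  free_Abelian_group (carrier (group_algebra G) \<times> carrier (class_ring :: 'f ring))"

definition ind_relations :: "(('a \<Rightarrow> 'f) \<times> 'f \<Rightarrow>\<^sub>0 int) set"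
  where "ind_relations = tensor_relations U_algebra (group_algebra G) (\<star>) class_ring (char_lact \<eta>)"

definition ind_generators :: "(('a \<Rightarrow> 'f) \<times> 'f \<Rightarrow>\<^sub>0 int) set"
  where "ind_generators =
    {frag_of (\<lambda>g. x g + x' g, c) - frag_of (x, c) - frag_of (x', c) | x x' c.
       x \<in> carrier (group_algebra G) \<and> x' \<in> carrier (group_algebra G)} \<union>
    {frag_of (x, c + c') - frag_of (x, c) - frag_of (x, c') | x c c'.
       x \<in> carrier (group_algebra G)} \<union>
    {frag_of (x \<star> r, c) - frag_of (x, char_lact \<eta> r c) | x r c.
       x \<in> carrier (group_algebra G) \<and> r \<in> carrier U_algebra}"

lemma ind_relations_eq: "ind_relations = generate frag_group ind_generators"
  unfolding ind_relations_def tensor_relations_def ind_generators_def group_algebra_add by simp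

lemma ind_generators_subset: "ind_generators \<subseteq> carrier frag_group"
  unfolding ind_generators_def
  by (auto simp: U_algebra_subset keys_frag_of dest!: subsetD[OF keys_diff])

lemma ind_generators_in_relations: "z \<in> ind_generators \<Longrightarrow> z \<in> ind_relations"
  unfolding ind_relations_eq by (rule generate.incl)

interpretation frag: comm_group frag_group
  by (rule abelian_free_Abelian_group)

lemma subgroup_ind_relations: "subgroup ind_relations frag_group"
  unfolding ind_relations_eq by (rule frag.generate_is_subgroup[OF ind_generators_subset])

interpretation rel: normal ind_relations frag_group
  by (rule frag.subgroup_imp_normal[OF subgroup_ind_relations])

lemma ind_relations_0: "0 \<in> ind_relations"
  using rel.one_closed by simp

lemma ind_relations_add: "a \<in> ind_relations \<Longrightarrow> b \<in> ind_relations \<Longrightarrow> a + b \<in> ind_relations"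
  using rel.m_closed by simp

lemma ind_relations_uminus: "a \<in> ind_relations \<Longrightarrow> - a \<in> ind_relations"
  using rel.m_inv_closed[of a] subsetD[OF rel.subset, of a]
  by (simp only: inv_free_Abelian_group carrier_free_Abelian_group_iff)

lemma ind_relations_diff: "a \<in> ind_relations \<Longrightarrow> b \<in> ind_relations \<Longrightarrow> a - b \<in> ind_relations"
  using ind_relations_add[OF _ ind_relations_uminus, of a b] by simp

lemma ind_relations_induct [consumes 1, case_names zero incl uminus add]:
  assumes "z \<in> ind_relations" "P 0" "\<And>z. z \<in> ind_generators \<Longrightarrow> P z"
    "\<And>z. z \<in> ind_generators \<Longrightarrow> P (- z)"
    "\<And>a b. P a \<Longrightarrow> P b \<Longrightarrow> P (a + b)"
  shows "P z"
  using assms(1) unfolding ind_relations_eq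
proof (induction z rule: generate.induct)
  case (inv z)
  then have "inv\<^bsub>frag_group\<^esub> z = - z"
    using subsetD[OF ind_generators_subset]
    by (intro inv_free_Abelian_group) (simp only: carrier_free_Abelian_group_iff)
  then show ?case using assms(4)[OF inv] by simp
qed (use assms in auto)

text \<open>The map that sends \<open>x\<close> tensor \<open>c\<close> to \<open>c\<close> times
  \<open>x \<star> \<e>\<close>, still on the free group and taken one coefficient \<open>g\<close>
  at a time so that its values are scalars.\<close>

definition tensor_eval :: "(('a \<Rightarrow> 'f) \<times> 'f \<Rightarrow>\<^sub>0 int) \<Rightarrow> 'a \<Rightarrow> 'f"
  where "tensor_eval z g = frag_eval (\<lambda>(x, c). c * (x \<star> \<e>) g) z"

text \<open>The two additivity relations vanish by bilinearity. The balancing relation vanishes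
  because \<open>r \<star> \<e>\<close> is the scalar by which \<open>r\<close> acts through
  \<open>\<eta>\<close>, times \<open>\<e>\<close>.\<close>

lemma tensor_eval_relations: "z \<in> ind_relations \<Longrightarrow> tensor_eval z g = 0"
proof (induction rule: ind_relations_induct)
  case (incl z)
  then consider x x' c where "x \<in> carrier (group_algebra G)" "x' \<in> carrier (group_algebra G)"
      "z = frag_of (\<lambda>g. x g + x' g, c) - frag_of (x, c) - frag_of (x', c)"
    | x c c' where "z = frag_of (x, c + c') - frag_of (x, c) - frag_of (x, c')"
    | x r c where "x \<in> carrier (group_algebra G)" "r \<in> carrier U_algebra"
      "z = frag_of (x \<star> r, c) - frag_of (x, char_lact \<eta> r c)"
    unfolding ind_generators_def by blast
  then show eval_z: "tensor_eval z g = 0"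
  proof cases
    case 1
    show ?thesis using 1(1,2) unfolding 1(3)
      by (simp add: tensor_eval_def frag_eval_diff conv_add_left distrib_left)
  next
    case 2
    show ?thesis unfolding 2 by (simp add: tensor_eval_def frag_eval_diff distrib_right)
  next
    case 3
    show ?thesis using 3(1,2) unfolding 3(3)
      by (simp add: tensor_eval_def frag_eval_diff conv_assoc U_algebra_subset conv_char_idem
          conv_scale_right char_lact_def)
  qed
  show "tensor_eval (- z) g = 0"
    using eval_z by (simp add: tensor_eval_def frag_eval_uminus)
qed (simp_all add: tensor_eval_def frag_eval_add frag_eval_uminus)

definition tensor_class :: "(('a \<Rightarrow> 'f) \<times> 'f \<Rightarrow>\<^sub>0 int) \<Rightarrow> ('a, 'f) ind_space"
  where "tensor_class z = ind_relations #>\<^bsub>frag_group\<^esub> z"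

lemma mem_tensor_class: "w \<in> tensor_class z \<longleftrightarrow> (\<exists>r\<in>ind_relations. w = r + z)"
  by (auto simp: tensor_class_def r_coset_def)

lemma tensor_class_eqI:
  assumes "z - w \<in> ind_relations"
  shows "tensor_class z = tensor_class w"
proof (intro equalityI subsetI)
  fix v assume "v \<in> tensor_class z"
  then obtain r where "r \<in> ind_relations" "v = r + z" by (auto simp: mem_tensor_class)
  then have "r + (z - w) \<in> ind_relations" "v = r + (z - w) + w"
    using ind_relations_add[OF _ assms] by simp_all
  then show "v \<in> tensor_class w" unfolding mem_tensor_class by blast
next
  fix v assume "v \<in> tensor_class w"
  then obtain r where "r \<in> ind_relations" "v = r + w" by (auto simp: mem_tensor_class)
  then have "r - (z - w) \<in> ind_relations" "v = r - (z - w) + z"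
    using ind_relations_diff[OF _ assms] by simp_all
  then show "v \<in> tensor_class z" unfolding mem_tensor_class by blast
qed

lemma tensor_class_eqD:
  assumes "tensor_class z = tensor_class w"
  shows "z - w \<in> ind_relations"
proof -
  have "z \<in> tensor_class z" using ind_relations_0 by (force simp: mem_tensor_class)
  then show ?thesis unfolding assms by (auto simp: mem_tensor_class)
qed

definition pure :: "('a \<Rightarrow> 'f) \<Rightarrow> ('a, 'f) ind_space"
  where "pure x = tensor_class (frag_of (x, 1))"

lemma pure_add_relation:
  assumes "x \<in> carrier (group_algebra G)" "y \<in> carrier (group_algebra G)"
  shows "frag_of (\<lambda>g. x g + y g, 1) - frag_of (x, 1) - frag_of (y, 1) \<in> ind_relations"
  using assms by (intro ind_generators_in_relations) (auto simp: ind_generators_def)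

lemma balanced_relation:
  assumes "x \<in> carrier (group_algebra G)" "r \<in> carrier U_algebra"
  shows "frag_of (x \<star> r, c) - frag_of (x, char_lact \<eta> r c) \<in> ind_relations"
  using assms by (intro ind_generators_in_relations) (auto simp: ind_generators_def)

text \<open>A scalar \<open>c\<close> in the second factor is carried across the tensor sign as the
  element \<open>ga_single \<one> c\<close> of the group algebra of \<open>U\<close>. With all
  second factors equal to 1, additivity in the first collapses a sum to a single tensor.\<close>

lemma tensor_class_pure:
  assumes "z \<in> carrier frag_group"
  shows "\<exists>x\<in>carrier (group_algebra G). tensor_class z = pure x"
proof -
  have "\<exists>x\<in>carrier (group_algebra G). z - frag_of (x, 1) \<in> ind_relations"
    using assms[unfolded carrier_free_Abelian_group_iff]
  proof (induction z rule: free_Abelian_group_induct[consumes 1, case_names zero diff one])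
    case zero
    show ?case
      using ind_relations_uminus[OF pure_add_relation[OF ga_zero_closed ga_zero_closed]]
      by (intro bexI[of _ "\<lambda>_. 0"]) (auto dest: ind_relations_uminus)
  next
    case (diff a b)
    then obtain x y where x: "x \<in> carrier (group_algebra G)" "a - frag_of (x, 1) \<in> ind_relations"
      and y: "y \<in> carrier (group_algebra G)" "b - frag_of (y, 1) \<in> ind_relations" by blast
    define d where "d = (\<lambda>g. x g + (- 1) * y g)"
    have d: "d \<in> carrier (group_algebra G)"
      unfolding d_def using x(1) y(1) by (intro ga_add_closed ga_scale_closed)
    have "(\<lambda>g. d g + y g) = x" by (simp add: d_def)
    then have "frag_of (x, 1) - frag_of (d, 1) - frag_of (y, 1) \<in> ind_relations"
      using pure_add_relation[OF d y(1)] by simp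
    from ind_relations_add[OF ind_relations_diff[OF x(2) y(2)] this]
    have "a - b - frag_of (d, 1) \<in> ind_relations" by (simp add: algebra_simps)
    with d show ?case by blast
  next
    case (one p)
    then obtain x c where p: "p = (x, c)" "x \<in> carrier (group_algebra G)" by auto
    have single: "ga_single \<one> c \<in> carrier U_algebra"
      by (auto simp: carrier_U_algebra_iff ga_single_def)
    have "char_lact \<eta> (ga_single \<one> c) 1 = c"
      using finite_U unfolding char_lact_eq[OF single]
      by (simp add: ga_single_def if_distrib[of "\<lambda>t. t * _"] \<eta>_one cong: if_cong)
    then have "frag_of (x \<star> ga_single \<one> c, 1) - frag_of p \<in> ind_relations"
      using balanced_relation[OF p(2) single, of 1] p(1) by simp
    from ind_relations_uminus[OF this] show ?case
      using p(2) by (intro bexI[of _ "x \<star> ga_single \<one> c"]) auto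
  qed
  then show ?thesis unfolding pure_def using tensor_class_eqI by blast
qed

lemma pure_char_idem:
  assumes "x \<in> carrier (group_algebra G)"
  shows "pure (x \<star> \<e>) = pure x"
  unfolding pure_def using balanced_relation[OF assms char_idem_in_U_algebra, of 1]
  by (intro tensor_class_eqI) (simp add: char_lact_idem)

text \<open>This makes the identification with F[G]e faithful. One direction holds because
  \<open>tensor_eval\<close> kills all relations, the other because \<open>\<e>\<close> crosses the
  tensor sign and acts on 1 as the identity.\<close>

lemma pure_eq_iff:
  assumes "x \<in> carrier (group_algebra G)" "y \<in> carrier (group_algebra G)"
  shows "pure x = pure y \<longleftrightarrow> x \<star> \<e> = y \<star> \<e>"
proof
  assume "pure x = pure y"
  then have "tensor_eval (frag_of (x, 1) - frag_of (y, 1)) g = 0" for g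
    unfolding pure_def by (intro tensor_eval_relations tensor_class_eqD)
  then show "x \<star> \<e> = y \<star> \<e>"
    by (simp add: tensor_eval_def frag_eval_diff fun_eq_iff)
next
  assume "x \<star> \<e> = y \<star> \<e>"
  then show "pure x = pure y" using pure_char_idem assms by metis
qed

abbreviation "ind_tensor \<equiv> tensor_product U_algebra (group_algebra G) (\<star>) class_ring (char_lact \<eta>)"

lemma ind_tensor_eq: "ind_tensor = frag_group Mod ind_relations"
  by (simp add: tensor_product_def ind_relations_def)

lemma carrier_ind_tensor: "carrier ind_tensor = pure ` carrier (group_algebra G)"
proof -
  have "carrier ind_tensor = tensor_class ` carrier frag_group"
    by (auto simp: ind_tensor_eq FactGroup_def RCOSETS_def tensor_class_def)
  also have "\<dots> = pure ` carrier (group_algebra G)"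
  proof (intro equalityI subsetI)
    fix C assume "C \<in> pure ` carrier (group_algebra G)"
    then obtain x where "x \<in> carrier (group_algebra G)" "C = tensor_class (frag_of (x, 1))"
      by (auto simp: pure_def)
    moreover from this have "frag_of (x, 1) \<in> carrier frag_group"
      by (simp add: keys_frag_of)
    ultimately show "C \<in> tensor_class ` carrier frag_group" by blast
  qed (use tensor_class_pure in blast)
  finally show ?thesis .
qed

lemma tensor_class_mult:
  assumes "z \<in> carrier frag_group" "w \<in> carrier frag_group"
  shows "tensor_class z \<otimes>\<^bsub>ind_tensor\<^esub> tensor_class w = tensor_class (z + w)"
  using rel.rcos_sum[OF assms] by (simp add: ind_tensor_eq FactGroup_def tensor_class_def)

lemma pure_mult:
  assumes x: "x \<in> carrier (group_algebra G)" and y: "y \<in> carrier (group_algebra G)"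
  shows "pure x \<otimes>\<^bsub>ind_tensor\<^esub> pure y = pure (\<lambda>g. x g + y g)"
proof -
  have "pure x \<otimes>\<^bsub>ind_tensor\<^esub> pure y = tensor_class (frag_of (x, 1) + frag_of (y, 1))"
    unfolding pure_def by (rule tensor_class_mult) (use x y in \<open>simp_all add: keys_frag_of\<close>)
  also have "\<dots> = pure (\<lambda>g. x g + y g)"
    unfolding pure_def using ind_relations_uminus[OF pure_add_relation[OF x y]]
    by (intro tensor_class_eqI) (simp add: algebra_simps)
  finally show ?thesis .
qed

lemma one_ind_tensor: "\<one>\<^bsub>ind_tensor\<^esub> = pure (\<lambda>_. 0)"
proof -
  have "\<one>\<^bsub>ind_tensor\<^esub> = tensor_class 0"
    by (auto simp: ind_tensor_eq FactGroup_def mem_tensor_class)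
  \<comment> \<open>Additivity for 0 + 0 = 0 is a relation that reduces to minus the generator with
    first factor 0.\<close>
  also have "\<dots> = pure (\<lambda>_. 0)"
    unfolding pure_def using pure_add_relation[OF ga_zero_closed ga_zero_closed]
    by (intro tensor_class_eqI) simp
  finally show ?thesis .
qed

text \<open>Left multiplication turns each generating relation into one of the same kind; for the
  balancing relation this is associativity. Hence the action on cosets is well defined.\<close>

lemma frag_extend_relations:
  assumes a: "a \<in> carrier (group_algebra G)" and z: "z \<in> ind_relations"
  shows "frag_extend (\<lambda>(x, c). frag_of (a \<star> x, c)) z \<in> ind_relations"
  using z
proof (induction rule: ind_relations_induct)
  case zero
  then show ?case by (simp add: ind_relations_0)
next
  case (incl z)
  then consider x x' c where "x \<in> carrier (group_algebra G)" "x' \<in> carrier (group_algebra G)"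
      "z = frag_of (\<lambda>g. x g + x' g, c) - frag_of (x, c) - frag_of (x', c)"
    | x c c' where "x \<in> carrier (group_algebra G)"
      "z = frag_of (x, c + c') - frag_of (x, c) - frag_of (x, c')"
    | x r c where "x \<in> carrier (group_algebra G)" "r \<in> carrier U_algebra"
      "z = frag_of (x \<star> r, c) - frag_of (x, char_lact \<eta> r c)"
    unfolding ind_generators_def by blast
  then have "frag_extend (\<lambda>(x, c). frag_of (a \<star> x, c)) z \<in> ind_generators"
  proof cases
    case 1
    then have "frag_extend (\<lambda>(x, c). frag_of (a \<star> x, c)) z
        = frag_of (\<lambda>g. (a \<star> x) g + (a \<star> x') g, c) - frag_of (a \<star> x, c) - frag_of (a \<star> x', c)"
      unfolding 1(3) using a by (simp add: frag_extend_diff conv_add_right)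
    then show ?thesis
      unfolding ind_generators_def using conv_closed[OF a] 1(1,2) by blast
  next
    case 2
    have "frag_extend (\<lambda>(x, c). frag_of (a \<star> x, c)) z
        = frag_of (a \<star> x, c + c') - frag_of (a \<star> x, c) - frag_of (a \<star> x, c')"
      unfolding 2(2) by (simp add: frag_extend_diff)
    then show ?thesis
      unfolding ind_generators_def using conv_closed[OF a] 2(1) by blast
  next
    case 3
    then have "frag_extend (\<lambda>(x, c). frag_of (a \<star> x, c)) z
        = frag_of (a \<star> x \<star> r, c) - frag_of (a \<star> x, char_lact \<eta> r c)"
      unfolding 3(3) using a by (simp add: frag_extend_diff conv_assoc U_algebra_subset)
    then show ?thesis
      unfolding ind_generators_def using conv_closed[OF a] 3(1,2) by blast
  qed
  then show "frag_extend (\<lambda>(x, c). frag_of (a \<star> x, c)) z \<in> ind_relations"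
    by (rule ind_generators_in_relations)
  then show "frag_extend (\<lambda>(x, c). frag_of (a \<star> x, c)) (- z) \<in> ind_relations"
    unfolding frag_extend_minus by (rule ind_relations_uminus)
next
  case (add a b)
  then show ?case by (simp add: frag_extend_add ind_relations_add)
qed

lemma ind_act_pure:
  assumes a: "a \<in> carrier (group_algebra G)"
  shows "ind_act G U \<eta> a (pure x) = pure (a \<star> x)"
proof -
  have "ind_act G U \<eta> a (pure x)
      = (\<Union>z\<in>pure x. tensor_class (frag_extend (\<lambda>(x, c). frag_of (a \<star> x, c)) z))"
    unfolding ind_act_def tensor_map_left_def tensor_class_def ind_relations_def by (rule refl)
  also have "\<dots> = (\<Union>z\<in>pure x. pure (a \<star> x))"
  proof (rule SUP_cong[OF refl])
    fix z assume "z \<in> pure x"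
    then obtain r where r: "r \<in> ind_relations" "z = r + frag_of (x, 1)"
      by (auto simp: pure_def mem_tensor_class)
    show "tensor_class (frag_extend (\<lambda>(x, c). frag_of (a \<star> x, c)) z) = pure (a \<star> x)"
      unfolding pure_def
      by (rule tensor_class_eqI) (simp add: r frag_extend_add frag_extend_relations[OF a])
  qed
  also have "\<dots> = pure (a \<star> x)"
  \<comment> \<open>The union of a constant family is that constant only over a nonempty index set,
    so a representative of the coset must be exhibited.\<close>
  proof -
    have "0 + frag_of (x, 1) \<in> pure x"
      unfolding pure_def mem_tensor_class using ind_relations_0 by blast
    then show ?thesis by auto
  qed
  finally show ?thesis .
qed

text \<open>The isomorphism onto F[G]e. The description is unambiguous because equal tensors
  \<open>pure x\<close> have equal products \<open>x \<star> \<e>\<close>.\<close>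

definition ideal_of :: "('a, 'f) ind_space \<Rightarrow> 'a \<Rightarrow> 'f"
  where "ideal_of C = (THE y. \<exists>x\<in>carrier (group_algebra G). C = pure x \<and> y = x \<star> \<e>)"

lemma ideal_of_pure:
  assumes "x \<in> carrier (group_algebra G)"
  shows "ideal_of (pure x) = x \<star> \<e>"
  unfolding ideal_of_def
  by (rule the_equality) (use assms in \<open>auto simp: pure_eq_iff\<close>)

section \<open>Transport of the module structure to F[G]e\<close>

lemma carrier_ind_module: "carrier (ind_module G U \<eta>) = pure ` carrier (group_algebra G)"
  using carrier_ind_tensor by (simp add: ind_module_def Let_def)

lemma ind_moduleE:
  assumes "C \<in> carrier (ind_module G U \<eta>)"
  obtains x where "x \<in> carrier (group_algebra G)" "C = pure x"
  using assms by (auto simp: carrier_ind_module)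

lemma zero_ind_module: "\<zero>\<^bsub>ind_module G U \<eta>\<^esub> = pure (\<lambda>_. 0)"
  using one_ind_tensor by (simp add: ind_module_def Let_def)

lemma zero_ind_module_closed: "\<zero>\<^bsub>ind_module G U \<eta>\<^esub> \<in> carrier (ind_module G U \<eta>)"
  unfolding zero_ind_module carrier_ind_module by (rule imageI[OF ga_zero_closed])

lemma add_ind_module:
  assumes "x \<in> carrier (group_algebra G)" "y \<in> carrier (group_algebra G)"
  shows "pure x \<oplus>\<^bsub>ind_module G U \<eta>\<^esub> pure y = pure (\<lambda>g. x g + y g)"
  using pure_mult[OF assms] by (simp add: ind_module_def Let_def)

lemma smult_ind_module:
  assumes "x \<in> carrier (group_algebra G)"
  shows "c \<odot>\<^bsub>ind_module G U \<eta>\<^esub> pure x = pure (\<lambda>g. c * x g)"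
  using assms by (simp add: ind_module_def Let_def ind_act_pure ga_single_one_conv)

lemma ind_rep_pure:
  assumes "h \<in> carrier G"
  shows "ind_rep G U \<eta> h (pure x) = pure (ga_single h 1 \<star> x)"
  using assms by (simp add: ind_rep_def ind_act_pure)

lemma ideal_of_closed:
  assumes "C \<in> carrier (ind_module G U \<eta>)"
  shows "ideal_of C \<in> carrier (group_algebra G)" "ideal_of C \<star> \<e> = ideal_of C"
  using assms by (auto elim!: ind_moduleE simp: ideal_of_pure conv_assoc char_idem_idem)

lemma ideal_of_inj:
  assumes "C \<in> carrier (ind_module G U \<eta>)" "D \<in> carrier (ind_module G U \<eta>)"
    "ideal_of C = ideal_of D"
  shows "C = D"
  using assms by (elim ind_moduleE) (simp add: ideal_of_pure pure_eq_iff)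

lemma ideal_of_add:
  assumes "C \<in> carrier (ind_module G U \<eta>)" "D \<in> carrier (ind_module G U \<eta>)"
  shows "ideal_of (C \<oplus>\<^bsub>ind_module G U \<eta>\<^esub> D) = (\<lambda>g. ideal_of C g + ideal_of D g)"
  using assms by (auto elim!: ind_moduleE simp: ideal_of_pure add_ind_module conv_add_left)

lemma ideal_of_zero: "ideal_of \<zero>\<^bsub>ind_module G U \<eta>\<^esub> = (\<lambda>_. 0)"
  by (simp add: zero_ind_module ideal_of_pure)

lemma ideal_of_smult:
  assumes "C \<in> carrier (ind_module G U \<eta>)"
  shows "ideal_of (c \<odot>\<^bsub>ind_module G U \<eta>\<^esub> C) = (\<lambda>g. c * ideal_of C g)"
  using assms by (auto elim!: ind_moduleE simp: ideal_of_pure smult_ind_module conv_scale_left)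

lemma ideal_of_rep:
  assumes "h \<in> carrier G" "C \<in> carrier (ind_module G U \<eta>)"
  shows "ideal_of (ind_rep G U \<eta> h C) = ga_single h 1 \<star> ideal_of C"
  using assms by (auto elim!: ind_moduleE simp: ideal_of_pure ind_rep_pure conv_assoc)

lemma ind_add_closed:
  assumes "C \<in> carrier (ind_module G U \<eta>)" "D \<in> carrier (ind_module G U \<eta>)"
  shows "C \<oplus>\<^bsub>ind_module G U \<eta>\<^esub> D \<in> carrier (ind_module G U \<eta>)"
  using assms by (elim ind_moduleE) (simp add: add_ind_module carrier_ind_module)

lemma ind_smult_closed:
  assumes "C \<in> carrier (ind_module G U \<eta>)"
  shows "c \<odot>\<^bsub>ind_module G U \<eta>\<^esub> C \<in> carrier (ind_module G U \<eta>)"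
  using assms by (elim ind_moduleE) (simp add: smult_ind_module carrier_ind_module)

lemma ind_rep_closed:
  assumes "h \<in> carrier G" "C \<in> carrier (ind_module G U \<eta>)"
  shows "ind_rep G U \<eta> h C \<in> carrier (ind_module G U \<eta>)"
  using assms by (elim ind_moduleE) (simp add: ind_rep_pure carrier_ind_module)

lemmas ind_module_closed = ind_add_closed ind_smult_closed ind_rep_closed zero_ind_module_closed

text \<open>\<open>ideal_of\<close> is injective and turns the operations on cosets into pointwise
  ones, so each axiom becomes an identity between functions.\<close>

lemma vectorspace_ind_module: "vectorspace class_ring (ind_module G U \<eta>)"
proof -
  let ?I = "ind_module G U \<eta>"
  note ideal_simps = ind_module_closed ideal_of_add ideal_of_zero ideal_of_smult
  have ag: "abelian_group ?I"
  proof (rule abelian_groupI)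
    fix C D E assume C: "C \<in> carrier ?I" and D: "D \<in> carrier ?I" and E: "E \<in> carrier ?I"
    show "C \<oplus>\<^bsub>?I\<^esub> D \<in> carrier ?I" using C D by (rule ind_add_closed)
    show "C \<oplus>\<^bsub>?I\<^esub> D \<oplus>\<^bsub>?I\<^esub> E = C \<oplus>\<^bsub>?I\<^esub> (D \<oplus>\<^bsub>?I\<^esub> E)"
      by (rule ideal_of_inj) (simp_all add: C D E ideal_simps add.assoc)
    show "C \<oplus>\<^bsub>?I\<^esub> D = D \<oplus>\<^bsub>?I\<^esub> C"
      by (rule ideal_of_inj) (simp_all add: C D ideal_simps add.commute)
    show "\<zero>\<^bsub>?I\<^esub> \<oplus>\<^bsub>?I\<^esub> C = C"
      by (rule ideal_of_inj) (simp_all add: C ideal_simps)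
    show "\<exists>D\<in>carrier ?I. D \<oplus>\<^bsub>?I\<^esub> C = \<zero>\<^bsub>?I\<^esub>"
    proof (rule bexI)
      show "(- 1) \<odot>\<^bsub>?I\<^esub> C \<oplus>\<^bsub>?I\<^esub> C = \<zero>\<^bsub>?I\<^esub>"
        by (rule ideal_of_inj) (simp_all add: C ideal_simps)
    qed (rule ind_smult_closed[OF C])
  qed (rule zero_ind_module_closed)
  have "module class_ring ?I"
  proof (rule moduleI[OF class_cring.is_cring ag])
    fix c d :: 'f and C D assume C: "C \<in> carrier ?I" and D: "D \<in> carrier ?I"
    show "c \<odot>\<^bsub>?I\<^esub> C \<in> carrier ?I" by (rule ind_smult_closed[OF C])
    show "(c \<oplus>\<^bsub>class_ring\<^esub> d) \<odot>\<^bsub>?I\<^esub> C = c \<odot>\<^bsub>?I\<^esub> C \<oplus>\<^bsub>?I\<^esub> d \<odot>\<^bsub>?I\<^esub> C"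
      by (rule ideal_of_inj) (simp_all add: C ideal_simps distrib_right)
    show "c \<odot>\<^bsub>?I\<^esub> (C \<oplus>\<^bsub>?I\<^esub> D) = c \<odot>\<^bsub>?I\<^esub> C \<oplus>\<^bsub>?I\<^esub> c \<odot>\<^bsub>?I\<^esub> D"
      by (rule ideal_of_inj) (simp_all add: C D ideal_simps distrib_left)
    show "(c \<otimes>\<^bsub>class_ring\<^esub> d) \<odot>\<^bsub>?I\<^esub> C = c \<odot>\<^bsub>?I\<^esub> (d \<odot>\<^bsub>?I\<^esub> C)"
      by (rule ideal_of_inj) (simp_all add: C ideal_simps mult.assoc)
    show "\<one>\<^bsub>class_ring\<^esub> \<odot>\<^bsub>?I\<^esub> C = C"
      by (rule ideal_of_inj) (simp_all add: C ideal_simps)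
  qed
  then show ?thesis by (simp add: vectorspace_def class_field)
qed

end

section \<open>Homomorphisms into the induced representation\<close>

context commutative_hecke_algebra
begin

lemma ind_rep_add:
  assumes h: "h \<in> carrier G" and C: "C \<in> carrier (ind_module G U \<eta>)"
    and D: "D \<in> carrier (ind_module G U \<eta>)"
  shows "ind_rep G U \<eta> h (C \<oplus>\<^bsub>ind_module G U \<eta>\<^esub> D)
      = ind_rep G U \<eta> h C \<oplus>\<^bsub>ind_module G U \<eta>\<^esub> ind_rep G U \<eta> h D"
  by (rule ideal_of_inj) (simp_all add: h C D ind_module_closed ideal_of_rep ideal_of_add
      ideal_of_closed(1) conv_add_right)

lemma ind_rep_smult:
  assumes h: "h \<in> carrier G" and C: "C \<in> carrier (ind_module G U \<eta>)"
  shows "ind_rep G U \<eta> h (c \<odot>\<^bsub>ind_module G U \<eta>\<^esub> C) = c \<odot>\<^bsub>ind_module G U \<eta>\<^esub> ind_rep G U \<eta> h C"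
  by (rule ideal_of_inj) (simp_all add: h C ind_module_closed ideal_of_rep ideal_of_smult
      ideal_of_closed(1) conv_scale_right)

lemma ind_rep_zero:
  assumes h: "h \<in> carrier G"
  shows "ind_rep G U \<eta> h \<zero>\<^bsub>ind_module G U \<eta>\<^esub> = \<zero>\<^bsub>ind_module G U \<eta>\<^esub>"
  by (rule ideal_of_inj) (simp_all add: h ind_module_closed ideal_of_rep ideal_of_zero)

end

locale irreducible_into_ind = commutative_hecke_algebra G U \<eta> +
    R: irreducible_representation G V \<rho>
  for G :: "('g, 'b) monoid_scheme" (structure) and U and \<eta> :: "'g \<Rightarrow> 'f :: alg_closed_field"
    and V :: "('f, 'v, 'c) module_scheme" and \<rho> :: "'g \<Rightarrow> 'v \<Rightarrow> 'v"
begin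

abbreviation "Ind \<equiv> ind_module G U \<eta>"
abbreviation "\<sigma> \<equiv> ind_rep G U \<eta>"
abbreviation "Hom \<equiv> rep_Hom G V \<rho> Ind \<sigma>"

sublocale Ind: vectorspace class_ring Ind
  by (rule vectorspace_ind_module)

lemma rho_closed: "g \<in> carrier G \<Longrightarrow> v \<in> carrier V \<Longrightarrow> \<rho> g v \<in> carrier V"
  using R.rep_linear unfolding module_hom_def by blast

lemma mem_Hom: "T \<in> carrier Hom \<longleftrightarrow> T \<in> extensional (carrier V) \<and>
    (\<forall>v\<in>carrier V. T v \<in> carrier Ind) \<and>
    (\<forall>v\<in>carrier V. \<forall>w\<in>carrier V. T (v \<oplus>\<^bsub>V\<^esub> w) = T v \<oplus>\<^bsub>Ind\<^esub> T w) \<and>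
    (\<forall>c. \<forall>v\<in>carrier V. T (c \<odot>\<^bsub>V\<^esub> v) = c \<odot>\<^bsub>Ind\<^esub> T v) \<and>
    (\<forall>g\<in>carrier G. \<forall>v\<in>carrier V. T (\<rho> g v) = \<sigma> g (T v))"
  unfolding rep_Hom_def module_hom_def by (auto simp: Pi_def)

lemma HomD:
  assumes "T \<in> carrier Hom"
  shows "T \<in> extensional (carrier V)" "v \<in> carrier V \<Longrightarrow> T v \<in> carrier Ind"
    "v \<in> carrier V \<Longrightarrow> w \<in> carrier V \<Longrightarrow> T (v \<oplus>\<^bsub>V\<^esub> w) = T v \<oplus>\<^bsub>Ind\<^esub> T w"
    "v \<in> carrier V \<Longrightarrow> T (c \<odot>\<^bsub>V\<^esub> v) = c \<odot>\<^bsub>Ind\<^esub> T v"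
    "g \<in> carrier G \<Longrightarrow> v \<in> carrier V \<Longrightarrow> T (\<rho> g v) = \<sigma> g (T v)"
  using assms unfolding mem_Hom by blast+

lemma Hom_ops:
  "S \<oplus>\<^bsub>Hom\<^esub> T = (\<lambda>v\<in>carrier V. S v \<oplus>\<^bsub>Ind\<^esub> T v)"
  "c \<odot>\<^bsub>Hom\<^esub> T = (\<lambda>v\<in>carrier V. c \<odot>\<^bsub>Ind\<^esub> T v)"
  "\<zero>\<^bsub>Hom\<^esub> = (\<lambda>v\<in>carrier V. \<zero>\<^bsub>Ind\<^esub>)"
  by (simp_all add: rep_Hom_def)

lemma Hom_add_closed:
  assumes S: "S \<in> carrier Hom" and T: "T \<in> carrier Hom"
  shows "S \<oplus>\<^bsub>Hom\<^esub> T \<in> carrier Hom"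
  unfolding mem_Hom Hom_ops using S T
  by (simp add: HomD ind_module_closed rho_closed ind_rep_add Ind.M.add.m_ac Ind.smult_r_distr)

lemma Hom_smult_closed:
  assumes T: "T \<in> carrier Hom"
  shows "c \<odot>\<^bsub>Hom\<^esub> T \<in> carrier Hom"
  unfolding mem_Hom Hom_ops using T
  by (simp add: HomD ind_module_closed rho_closed ind_rep_smult Ind.smult_r_distr
      Ind.smult_assoc1[symmetric, simplified] mult.commute)

lemma Hom_zero_closed: "\<zero>\<^bsub>Hom\<^esub> \<in> carrier Hom"
  unfolding mem_Hom Hom_ops
  by (simp add: ind_module_closed rho_closed ind_rep_zero)

lemma Hom_eqI:
  assumes "S \<in> carrier Hom" "T \<in> carrier Hom" "\<And>v. v \<in> carrier V \<Longrightarrow> S v = T v"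
  shows "S = T"
  using HomD(1)[OF assms(1)] HomD(1)[OF assms(2)] assms(3) by (rule extensionalityI)

lemma vectorspace_Hom: "vectorspace class_ring Hom"
proof -
  note closed = Hom_add_closed Hom_smult_closed Hom_zero_closed
  have ag: "abelian_group Hom"
  proof (rule abelian_groupI)
    fix S T Q assume S: "S \<in> carrier Hom" and T: "T \<in> carrier Hom" and Q: "Q \<in> carrier Hom"
    show "S \<oplus>\<^bsub>Hom\<^esub> T \<in> carrier Hom" using S T by (rule Hom_add_closed)
    show "S \<oplus>\<^bsub>Hom\<^esub> T \<oplus>\<^bsub>Hom\<^esub> Q = S \<oplus>\<^bsub>Hom\<^esub> (T \<oplus>\<^bsub>Hom\<^esub> Q)"
      by (rule Hom_eqI) (simp_all add: closed S T Q, simp add: Hom_ops HomD S T Q Ind.M.add.m_assoc)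
    show "S \<oplus>\<^bsub>Hom\<^esub> T = T \<oplus>\<^bsub>Hom\<^esub> S"
      by (rule Hom_eqI) (simp_all add: closed S T Q, simp add: Hom_ops HomD S T Ind.M.add.m_comm)
    show "\<zero>\<^bsub>Hom\<^esub> \<oplus>\<^bsub>Hom\<^esub> S = S"
      by (rule Hom_eqI) (simp_all add: closed S, simp add: Hom_ops HomD S)
    show "\<exists>T\<in>carrier Hom. T \<oplus>\<^bsub>Hom\<^esub> S = \<zero>\<^bsub>Hom\<^esub>"
    proof (rule bexI)
      show "(- 1) \<odot>\<^bsub>Hom\<^esub> S \<oplus>\<^bsub>Hom\<^esub> S = \<zero>\<^bsub>Hom\<^esub>"
      proof (rule Hom_eqI)
        fix v assume v: "v \<in> carrier V"
        have "(- 1) \<odot>\<^bsub>Ind\<^esub> S v \<oplus>\<^bsub>Ind\<^esub> S v = \<zero>\<^bsub>Ind\<^esub>"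
          by (rule ideal_of_inj)
            (simp_all add: HomD(2)[OF S v] ind_module_closed ideal_of_add ideal_of_smult ideal_of_zero)
        then show "((- 1) \<odot>\<^bsub>Hom\<^esub> S \<oplus>\<^bsub>Hom\<^esub> S) v = \<zero>\<^bsub>Hom\<^esub> v" by (simp add: Hom_ops v)
      qed (simp_all add: closed S)
    qed (rule Hom_smult_closed[OF S])
  qed (rule Hom_zero_closed)
  have "module class_ring Hom"
  proof (rule moduleI[OF class_cring.is_cring ag])
    fix c d :: 'f and S T assume S: "S \<in> carrier Hom" and T: "T \<in> carrier Hom"
    show "c \<odot>\<^bsub>Hom\<^esub> S \<in> carrier Hom" using S by (rule Hom_smult_closed)
    show "(c \<oplus>\<^bsub>class_ring\<^esub> d) \<odot>\<^bsub>Hom\<^esub> S = c \<odot>\<^bsub>Hom\<^esub> S \<oplus>\<^bsub>Hom\<^esub> d \<odot>\<^bsub>Hom\<^esub> S"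
      by (rule Hom_eqI) (simp_all add: closed S,
          simp add: Hom_ops HomD S Ind.smult_l_distr[simplified])
    show "c \<odot>\<^bsub>Hom\<^esub> (S \<oplus>\<^bsub>Hom\<^esub> T) = c \<odot>\<^bsub>Hom\<^esub> S \<oplus>\<^bsub>Hom\<^esub> c \<odot>\<^bsub>Hom\<^esub> T"
      by (rule Hom_eqI) (simp_all add: closed S T, simp add: Hom_ops HomD S T Ind.smult_r_distr)
    show "(c \<otimes>\<^bsub>class_ring\<^esub> d) \<odot>\<^bsub>Hom\<^esub> S = c \<odot>\<^bsub>Hom\<^esub> (d \<odot>\<^bsub>Hom\<^esub> S)"
      by (rule Hom_eqI) (simp_all add: closed S,
          simp add: Hom_ops HomD S Ind.smult_assoc1[simplified])
    show "\<one>\<^bsub>class_ring\<^esub> \<odot>\<^bsub>Hom\<^esub> S = S"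
      by (rule Hom_eqI) (simp_all add: closed S, simp add: Hom_ops HomD S Ind.smult_one[simplified])
  qed
  then show ?thesis by (simp add: vectorspace_def class_field)
qed

lemma stable_subspace:
  assumes W: "W \<subseteq> carrier V" "\<zero>\<^bsub>V\<^esub> \<in> W"
    and "\<And>v w. v \<in> W \<Longrightarrow> w \<in> W \<Longrightarrow> v \<oplus>\<^bsub>V\<^esub> w \<in> W"
    and "\<And>c v. v \<in> W \<Longrightarrow> c \<odot>\<^bsub>V\<^esub> v \<in> W"
    and "\<And>g v. g \<in> carrier G \<Longrightarrow> v \<in> W \<Longrightarrow> \<rho> g v \<in> W"
  shows "W = {\<zero>\<^bsub>V\<^esub>} \<or> W = carrier V"
proof (rule R.irreducible)
  show "VectorSpace.subspace class_ring W V"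
    unfolding VectorSpace.subspace_def submodule_def
    using assms R.vectorspace_axioms R.module_axioms by auto
qed (use assms in blast)

text \<open>By irreducibility a nonzero \<open>T\<close> is injective, and its image, read in F[G]e,
  is a minimal left ideal. So \<open>S\<close> is \<open>T\<close> followed by an equivariant map on
  this ideal, which \<open>minimal_left_ideal_hom\<close> shows to be a scalar.\<close>

lemma Hom_proportional:
  assumes T: "T \<in> carrier Hom" and T_nonzero: "T \<noteq> \<zero>\<^bsub>Hom\<^esub>" and S: "S \<in> carrier Hom"
  shows "\<exists>c. S = c \<odot>\<^bsub>Hom\<^esub> T"
proof -
  let ?t = "\<lambda>v. ideal_of (T v)" and ?s = "\<lambda>v. ideal_of (S v)"
  have hom: "ideal_of (Q (v \<oplus>\<^bsub>V\<^esub> w)) = (\<lambda>g. ideal_of (Q v) g + ideal_of (Q w) g)"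
    "ideal_of (Q (c \<odot>\<^bsub>V\<^esub> v)) = (\<lambda>g. c * ideal_of (Q v) g)"
    "g \<in> carrier G \<Longrightarrow> ideal_of (Q (\<rho> g v)) = ga_single g 1 \<star> ideal_of (Q v)"
    "ideal_of (Q v) \<in> carrier (group_algebra G)" "ideal_of (Q v) \<star> \<e> = ideal_of (Q v)"
    if "Q \<in> carrier Hom" "v \<in> carrier V" "w \<in> carrier V" for Q v w c g
    using that by (simp_all add: HomD ideal_of_add ideal_of_smult ideal_of_rep ideal_of_closed)
  have V0: "\<zero>\<^bsub>V\<^esub> \<in> carrier V" by simp
  have t0: "?t \<zero>\<^bsub>V\<^esub> = (\<lambda>_. 0)"
    using hom(2)[OF T V0 V0, of 0] R.lmult_0[OF V0] by simp
  have kernel: "v = \<zero>\<^bsub>V\<^esub>" if v: "v \<in> carrier V" "?t v = (\<lambda>_. 0)" for v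
  proof -
    let ?K = "{v \<in> carrier V. ?t v = (\<lambda>_. 0)}"
    have "?K = {\<zero>\<^bsub>V\<^esub>} \<or> ?K = carrier V"
      by (rule stable_subspace) (auto simp: hom[OF T] t0 rho_closed)
    moreover have "?K \<noteq> carrier V"
    proof
      assume K: "?K = carrier V"
      have "T = \<zero>\<^bsub>Hom\<^esub>"
      proof (rule Hom_eqI[OF T Hom_zero_closed])
        fix w assume w: "w \<in> carrier V"
        then have "?t w = (\<lambda>_. 0)" using K by blast
        then show "T w = \<zero>\<^bsub>Hom\<^esub> w"
          using w by (intro ideal_of_inj) (simp_all add: HomD[OF T] Hom_ops ideal_of_zero)
      qed
      with T_nonzero show False by simp
    qed
    ultimately show ?thesis using v by blast
  qed
  have inj: "inj_on ?t (carrier V)"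
  proof (rule inj_onI)
    fix v w assume vw: "v \<in> carrier V" "w \<in> carrier V" "?t v = ?t w"
    then have "?t (v \<oplus>\<^bsub>V\<^esub> (- 1) \<odot>\<^bsub>V\<^esub> w) = (\<lambda>_. 0)"
      by (simp add: hom[OF T])
    then have "v \<oplus>\<^bsub>V\<^esub> (- 1) \<odot>\<^bsub>V\<^esub> w = \<zero>\<^bsub>V\<^esub>"
      using vw by (intro kernel) simp_all
    moreover have "(- 1) \<odot>\<^bsub>V\<^esub> w = \<ominus>\<^bsub>V\<^esub> w"
      using R.smult_minus_1[OF vw(2)] by (simp add: class_ring_simps)
    ultimately show "v = w"
      using vw R.M.minus_unique by (metis R.M.add.inv_closed R.M.add.inv_solve_right' R.M.l_zero R.M.zero_closed)
  qed
  define A where "A = ?t ` carrier V"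
  \<comment> \<open>\<open>S\<close> after the inverse of \<open>T\<close>, with both read in
    F[G]e.\<close>
  define s where "s x = ?s (inv_into (carrier V) ?t x)" for x
  have s_t: "s (?t v) = ?s v" if "v \<in> carrier V" for v
    unfolding s_def inv_into_f_f[OF inj that] ..
  have A: "left_ideal A"
    unfolding left_ideal_def A_def
  proof (intro conjI ballI allI)
    show "(\<lambda>_. 0) \<in> ?t ` carrier V" using t0 V0 by (intro image_eqI[of _ _ "\<zero>\<^bsub>V\<^esub>"]) auto
  next
    fix x y c a assume "x \<in> ?t ` carrier V"
    then obtain v where v: "v \<in> carrier V" "x = ?t v" by blast
    show "(\<lambda>g. c * x g) \<in> ?t ` carrier V"
      unfolding v(2) hom(2)[OF T v(1) v(1), symmetric] by (rule imageI) (use v in simp)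
    show "ga_single a 1 \<star> x \<in> ?t ` carrier V" if "a \<in> carrier G"
      unfolding v(2) hom(3)[OF T v(1) v(1) that, symmetric] by (rule imageI) (use v that rho_closed in simp)
    assume "y \<in> ?t ` carrier V"
    then obtain w where w: "w \<in> carrier V" "y = ?t w" by blast
    show "(\<lambda>g. x g + y g) \<in> ?t ` carrier V"
      unfolding v(2) w(2) hom(1)[OF T v(1) w(1), symmetric] by (rule imageI) (use v w in simp)
  qed (auto simp: hom(4)[OF T])
  have minimal: "W = {\<lambda>_. 0} \<or> W = A" if W: "left_ideal W" "W \<subseteq> A" for W
  proof -
    let ?W = "{v \<in> carrier V. ?t v \<in> W}"
    have W_eq: "W = ?t ` ?W" using W(2) by (auto simp: A_def)
    have "?W = {\<zero>\<^bsub>V\<^esub>} \<or> ?W = carrier V"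
      by (rule stable_subspace) (auto simp: hom[OF T] t0 rho_closed left_idealD[OF W(1)])
    then show ?thesis
    proof
      assume "?W = {\<zero>\<^bsub>V\<^esub>}"
      then show ?thesis using W_eq t0 by simp
    next
      assume "?W = carrier V"
      then show ?thesis using W_eq by (simp add: A_def)
    qed
  qed
  obtain c where c: "\<And>x. x \<in> A \<Longrightarrow> s x = (\<lambda>g. c * x g)"
  proof (rule minimal_left_ideal_hom[of A s])
    fix x y c a assume "x \<in> A"
    then obtain v where v: "v \<in> carrier V" "x = ?t v" by (auto simp: A_def)
    show "s (\<lambda>g. c * x g) = (\<lambda>g. c * s x g)"
      unfolding v(2) hom(2)[OF T v(1) v(1), symmetric] using v(1) by (simp add: s_t hom[OF S])
    show "s (ga_single a 1 \<star> x) = ga_single a 1 \<star> s x" if "a \<in> carrier G"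
      unfolding v(2) hom(3)[OF T v(1) v(1) that, symmetric] using v(1) that
      by (simp add: s_t hom[OF S] rho_closed)
    assume "y \<in> A"
    then obtain w where w: "w \<in> carrier V" "y = ?t w" by (auto simp: A_def)
    show "s (\<lambda>g. x g + y g) = (\<lambda>g. s x g + s y g)"
      unfolding v(2) w(2) hom(1)[OF T v(1) w(1), symmetric] using v(1) w(1)
      by (simp add: s_t hom[OF S])
  qed (use A minimal in \<open>auto simp: A_def s_t hom[OF T] hom[OF S]\<close>)
  have "S = c \<odot>\<^bsub>Hom\<^esub> T"
  proof (rule Hom_eqI[OF S Hom_smult_closed[OF T]])
    fix v assume v: "v \<in> carrier V"
    then have "?s v = (\<lambda>g. c * ?t v g)" using c[of "?t v"] s_t by (simp add: A_def)
    with v show "S v = (c \<odot>\<^bsub>Hom\<^esub> T) v"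
      by (intro ideal_of_inj)
        (simp_all add: HomD[OF S] HomD[OF T] Hom_ops ind_module_closed ideal_of_smult)
  qed
  then show ?thesis ..
qed

theorem dim_Hom_le_1: "vectorspace.fin_dim class_ring Hom \<and> vectorspace.dim class_ring Hom \<le> 1"
proof -
  interpret H: vectorspace class_ring Hom by (rule vectorspace_Hom)
  obtain T where T: "T \<in> carrier Hom" "H.span {T} = carrier Hom"
  proof (cases "carrier Hom = {\<zero>\<^bsub>Hom\<^esub>}")
    case True
    \<comment> \<open>The zero space is spanned by a one-element set too, so both cases feed the
      same bound on the dimension.\<close>
    have "H.span {\<zero>\<^bsub>Hom\<^esub>} = carrier Hom"
      using H.in_own_span[of "{\<zero>\<^bsub>Hom\<^esub>}"] H.span_is_subset2[of "{\<zero>\<^bsub>Hom\<^esub>}"] True by auto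
    then show ?thesis using that Hom_zero_closed by blast
  next
    case False
    then obtain T where T: "T \<in> carrier Hom" "T \<noteq> \<zero>\<^bsub>Hom\<^esub>" using Hom_zero_closed by blast
    interpret span: submodule class_ring "H.span {T}" Hom
      by (rule H.span_is_submodule) (use T in simp)
    have "T \<in> H.span {T}" using H.in_own_span[of "{T}"] T by auto
    then have "carrier Hom \<subseteq> H.span {T}"
      using Hom_proportional[OF T] span.smult_closed by fastforce
    then show ?thesis using that[OF T(1)] span.subset by blast
  qed
  then show ?thesis
    using H.gen_ge_dim[of "{T}"] unfolding H.fin_dim_def by (auto intro!: exI[of _ "{T}"])
qed

end

section \<open>Unitriangular matrices and the antitranspose\<close>

lemma mat_mult_entry:
  assumes "A \<in> carrier_mat n n" "B \<in> carrier_mat n n" "i < n" "j < n"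
  shows "(A * B) $$ (i, j) = (\<Sum>k<n. A $$ (i, k) * B $$ (k, j))"
  using assms by (simp add: scalar_prod_def lessThan_atLeast0)

lemma carrier_GL: "carrier (GL n :: 'k :: field mat monoid) = {A \<in> carrier_mat n n. det A \<noteq> 0}"
proof -
  have "A \<in> Units (ring_mat TYPE('k) n ()) \<longleftrightarrow> A \<in> carrier_mat n n \<and> det A \<noteq> 0" for A :: "'k mat"
    using unit_imp_det_non_zero[of A n "()"] det_non_zero_imp_unit[of A n "()"]
    by (auto simp: Units_def ring_mat_simps)
  then show ?thesis by (auto simp: GL_def units_of_def)
qed

lemma GL_simps [simp]:
  "monoid.mult (GL n :: 'k :: field mat monoid) = (*)" "\<one>\<^bsub>(GL n :: 'k mat monoid)\<^esub> = 1\<^sub>m n"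
  by (simp_all add: GL_def units_of_def ring_mat_simps)

lemma GL_carrier_mat: "A \<in> carrier (GL n) \<Longrightarrow> A \<in> carrier_mat n n"
  by (simp add: carrier_GL)

lemma group_GL: "group (GL n :: 'k :: field mat monoid)"
proof -
  interpret ring "ring_mat TYPE('k) n ()" by (rule ring_mat)
  show ?thesis unfolding GL_def by (rule units_group)
qed

lemma finite_carrier_mat: "finite (carrier_mat n m :: 'k :: finite mat set)"
proof -
  let ?D = "{..<n} \<times> {..<m}"
  have "inj_on (\<lambda>A. restrict (($$) A) ?D) (carrier_mat n m :: 'k mat set)"
  proof (rule inj_onI)
    fix A B :: "'k mat" assume A: "A \<in> carrier_mat n m" "B \<in> carrier_mat n m"
      and eq: "restrict (($$) A) ?D = restrict (($$) B) ?D"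
    show "A = B"
    proof (rule eq_matI)
      fix i j assume "i < dim_row B" "j < dim_col B"
      then have "(i, j) \<in> ?D" using A by auto
      then show "A $$ (i, j) = B $$ (i, j)" using fun_cong[OF eq, of "(i, j)"] by simp
    qed (use A in auto)
  qed
  moreover have "(\<lambda>A. restrict (($$) A) ?D) ` carrier_mat n m \<subseteq> (?D \<rightarrow>\<^sub>E (UNIV :: 'k set))"
    by (intro image_subsetI restrict_PiE) simp
  moreover have "finite (?D \<rightarrow>\<^sub>E (UNIV :: 'k set))" by (intro finite_PiE) auto
  ultimately show ?thesis by (meson finite_imageD finite_subset)
qed

lemma unitriangular_iff:
  "A \<in> unitriangular n \<longleftrightarrow> A \<in> carrier_mat n n \<and>
     (\<forall>i<n. \<forall>j<n. j < i \<longrightarrow> A $$ (i, j) = 0) \<and> (\<forall>i<n. A $$ (i, i) = 1)"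
  by (auto simp: unitriangular_def upper_triangular_def)

lemma unitriangularD:
  assumes "A \<in> unitriangular n"
  shows "A \<in> carrier_mat n n" "j < i \<Longrightarrow> i < n \<Longrightarrow> A $$ (i, j) = 0" "i < n \<Longrightarrow> A $$ (i, i) = 1"
  using assms by (auto simp: unitriangular_iff)

lemma unitriangular_subset: "(unitriangular n :: 'k :: field mat set) \<subseteq> carrier (GL n)"
proof
  fix A :: "'k mat" assume A: "A \<in> unitriangular n"
  then have "det A = prod_list (diag_mat A)"
    by (intro det_upper_triangular) (auto simp: unitriangular_def)
  also have "diag_mat A = replicate n 1"
    using A unfolding diag_mat_def by (intro replicate_eqI) (auto simp: unitriangular_iff)
  finally have "det A = 1" by simp
  then show "A \<in> carrier (GL n)" using A by (simp add: carrier_GL unitriangular_def)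
qed

lemma unitriangular_mult:
  fixes A B :: "'k :: field mat"
  assumes A: "A \<in> unitriangular n" and B: "B \<in> unitriangular n"
  shows "A * B \<in> unitriangular n"
    and "Suc i < n \<Longrightarrow> (A * B) $$ (i, Suc i) = A $$ (i, Suc i) + B $$ (i, Suc i)"
proof -
  note entry = mat_mult_entry[OF unitriangularD(1)[OF A] unitriangularD(1)[OF B]]
  have low: "(A * B) $$ (i, j) = 0" if "j < i" "i < n" for i j
  proof -
    have "A $$ (i, k) * B $$ (k, j) = 0" if "k < n" for k
      using that \<open>j < i\<close> \<open>i < n\<close> unitriangularD(2)[OF A, of k i] unitriangularD(2)[OF B, of j k]
      by (cases "k < i") auto
    then show ?thesis using that by (subst entry) (auto intro: sum.neutral)
  qed
  have diag: "(A * B) $$ (i, i) = 1" if "i < n" for i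
  proof -
    have "A $$ (i, k) * B $$ (k, i) = (if k = i then 1 else 0)" if "k < n" for k
      using that \<open>i < n\<close> unitriangularD[OF A] unitriangularD[OF B]
      by (cases k i rule: linorder_cases) auto
    then have "(A * B) $$ (i, i) = (\<Sum>k<n. if k = i then 1 else 0)"
      unfolding entry[OF that that] by (intro sum.cong) auto
    then show ?thesis using that by simp
  qed
  show "A * B \<in> unitriangular n"
    using low diag unitriangularD(1)[OF A] unitriangularD(1)[OF B] by (simp add: unitriangular_iff)
  assume i: "Suc i < n"
  have "A $$ (i, k) * B $$ (k, Suc i)
      = (if k = i then B $$ (i, Suc i) else 0) + (if k = Suc i then A $$ (i, Suc i) else 0)"
    if k: "k < n" for k
  proof -
    consider "k < i" | "k = i" | "k = Suc i" | "Suc i < k" by linarith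
    then show ?thesis
      using k i unitriangularD[OF A] unitriangularD[OF B] by cases auto
  qed
  then have "(A * B) $$ (i, Suc i) = (\<Sum>k<n. (if k = i then B $$ (i, Suc i) else 0)
      + (if k = Suc i then A $$ (i, Suc i) else 0))"
    using i by (subst entry) (auto intro!: sum.cong)
  also have "\<dots> = A $$ (i, Suc i) + B $$ (i, Suc i)"
    using i by (simp add: sum.distrib)
  finally show "(A * B) $$ (i, Suc i) = A $$ (i, Suc i) + B $$ (i, Suc i)" .
qed

lemma one_unitriangular: "1\<^sub>m n \<in> unitriangular n"
  by (auto simp: unitriangular_iff)

text \<open>Inverses come from finiteness: left multiplication by \<open>A\<close> is an injective
  map of a finite set to itself, hence it reaches the identity matrix.\<close>

lemma subgroup_unitriangular: "subgroup (unitriangular n) (GL n :: 'k :: {field, finite} mat monoid)"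
proof -
  interpret group "GL n :: 'k mat monoid" by (rule group_GL)
  have fin: "finite (unitriangular n :: 'k mat set)"
    by (rule finite_subset[OF _ finite_carrier_mat[of n n]]) (auto simp: unitriangular_def)
  show ?thesis
  proof (rule subgroupI)
    fix A :: "'k mat" assume A: "A \<in> unitriangular n"
    then have AG: "A \<in> carrier (GL n)" using unitriangular_subset by blast
    have "inj_on ((*) A) (unitriangular n)"
    proof (rule inj_onI)
      fix B C :: "'k mat" assume "B \<in> unitriangular n" "C \<in> unitriangular n" "A * B = A * C"
      then show "B = C"
        using subsetD[OF unitriangular_subset] AG by (intro l_cancel[of A B C]) auto
    qed
    then have "(*) A ` unitriangular n = unitriangular n"
      using unitriangular_mult(1)[OF A] by (intro endo_inj_surj[OF fin]) auto
    then obtain B where B: "B \<in> unitriangular n" "A * B = 1\<^sub>m n"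
      using one_unitriangular by (metis imageE)
    have BG: "B \<in> carrier (GL n)" using B(1) unitriangular_subset by blast
    have "inv\<^bsub>GL n\<^esub> B = A"
      by (rule inv_equality) (use AG BG B(2) in simp_all)
    then have "inv\<^bsub>GL n\<^esub> A = B" using inv_inv[OF BG] by simp
    with B show "inv\<^bsub>GL n\<^esub> A \<in> unitriangular n" by simp
  next
    show "(unitriangular n :: 'k mat set) \<noteq> {}" using one_unitriangular by blast
  qed (use unitriangular_subset unitriangular_mult(1) in simp_all)
qed

text \<open>The entries above the diagonal are free, so \<open>N\<close> counts the pairs
  \<open>i < j < n\<close>. A power of the field size is invertible as soon as the field size
  is.\<close>

lemma card_unitriangular:
  "\<exists>N. card (unitriangular n :: 'k :: {field, finite} mat set) = card (UNIV :: 'k set) ^ N"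
proof -
  let ?P = "{(i, j). i < j \<and> j < n}"
  have fin: "finite ?P" by (rule finite_subset[of _ "{..<n} \<times> {..<n}"]) auto
  have "bij_betw (\<lambda>A. restrict (($$) A) ?P) (unitriangular n) (?P \<rightarrow>\<^sub>E (UNIV :: 'k set))"
  proof (rule bij_betw_byWitness[where
        f' = "\<lambda>f. mat n n (\<lambda>(i, j). if i < j then f (i, j) else if i = j then 1 else 0)"])
    show "\<forall>A\<in>unitriangular n :: 'k mat set. mat n n (\<lambda>(i, j). if i < j then restrict (($$) A) ?P (i, j)
        else if i = j then 1 else 0) = A"
    proof
      fix A :: "'k mat" assume A: "A \<in> unitriangular n"
      show "mat n n (\<lambda>(i, j). if i < j then restrict (($$) A) ?P (i, j)
          else if i = j then 1 else 0) = A" (is "?B = A")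
      proof (rule eq_matI)
        fix i j assume "i < dim_row A" "j < dim_col A"
        then show "?B $$ (i, j) = A $$ (i, j)"
          using A by (cases i j rule: linorder_cases) (auto simp: unitriangular_iff)
      qed (use A in \<open>auto simp: unitriangular_iff\<close>)
    qed
    show "\<forall>f\<in>?P \<rightarrow>\<^sub>E (UNIV :: 'k set). restrict (($$) (mat n n (\<lambda>(i, j). if i < j then f (i, j)
        else if i = j then 1 else 0))) ?P = f"
      by (auto simp: fun_eq_iff PiE_def extensional_def)
    show "(\<lambda>A. restrict (($$) A) ?P) ` unitriangular n \<subseteq> (?P \<rightarrow>\<^sub>E (UNIV :: 'k set))"
      by (intro image_subsetI restrict_PiE) simp
  qed (auto simp: unitriangular_iff)
  then have "card (unitriangular n :: 'k mat set) = card (?P \<rightarrow>\<^sub>E (UNIV :: 'k set))"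
    by (rule bij_betw_same_card)
  then show ?thesis using card_PiE[OF fin, of "\<lambda>_. UNIV :: 'k set"] by auto
qed

text \<open>The transpose conjugated by the permutation matrix of
  \<open>i \<mapsto> n - 1 - i\<close>. Plain transposition would send upper triangular matrices to
  lower triangular ones; the conjugation brings them back.\<close>

definition antitranspose :: "nat \<Rightarrow> 'k mat \<Rightarrow> 'k mat"
  where "antitranspose n A = mat n n (\<lambda>(i, j). A $$ (n - Suc j, n - Suc i))"

lemma antitranspose_carrier [simp]: "antitranspose n A \<in> carrier_mat n n"
  by (simp add: antitranspose_def)

lemma antitranspose_entry [simp]:
  "i < n \<Longrightarrow> j < n \<Longrightarrow> antitranspose n A $$ (i, j) = A $$ (n - Suc j, n - Suc i)"
  by (simp add: antitranspose_def)

lemma antitranspose_antitranspose: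
  "A \<in> carrier_mat n n \<Longrightarrow> antitranspose n (antitranspose n A) = A"
  by (rule eq_matI) (auto simp: antitranspose_def)

lemma antitranspose_mult:
  fixes A B :: "'k :: comm_ring_1 mat"
  assumes A: "A \<in> carrier_mat n n" and B: "B \<in> carrier_mat n n"
  shows "antitranspose n (A * B) = antitranspose n B * antitranspose n A"
proof (rule eq_matI)
  fix i j assume "i < dim_row (antitranspose n B * antitranspose n A)"
    "j < dim_col (antitranspose n B * antitranspose n A)"
  then have ij: "i < n" "j < n" by (auto simp: antitranspose_def)
  have "antitranspose n (A * B) $$ (i, j) = (\<Sum>k<n. A $$ (n - Suc j, k) * B $$ (k, n - Suc i))"
    using ij by (simp add: mat_mult_entry[OF A B])
  also have "\<dots> = (\<Sum>k<n. A $$ (n - Suc j, n - Suc k) * B $$ (n - Suc k, n - Suc i))"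
    by (rule sum.nat_diff_reindex[symmetric])
  also have "\<dots> = (antitranspose n B * antitranspose n A) $$ (i, j)"
    using ij by (simp add: mat_mult_entry[OF antitranspose_carrier antitranspose_carrier] mult.commute)
  finally show "antitranspose n (A * B) $$ (i, j) = (antitranspose n B * antitranspose n A) $$ (i, j)" .
qed (auto simp: antitranspose_def)

lemma antitranspose_one: "antitranspose n (1\<^sub>m n) = 1\<^sub>m n"
  by (rule eq_matI) (auto simp: antitranspose_def)

lemma antitranspose_GL:
  fixes A :: "'k :: field mat"
  assumes A: "A \<in> carrier (GL n)"
  shows "antitranspose n A \<in> carrier (GL n)"
proof -
  interpret group "GL n :: 'k mat monoid" by (rule group_GL)
  have "A * inv\<^bsub>GL n\<^esub> A = 1\<^sub>m n" "inv\<^bsub>GL n\<^esub> A \<in> carrier_mat n n"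
    using r_inv[OF A] GL_carrier_mat[OF inv_closed[OF A]] by simp_all
  then have "antitranspose n (inv\<^bsub>GL n\<^esub> A) * antitranspose n A = 1\<^sub>m n"
    using antitranspose_mult[OF GL_carrier_mat[OF A]] antitranspose_one by metis
  then have "det (antitranspose n (inv\<^bsub>GL n\<^esub> A)) * det (antitranspose n A) = 1"
    using det_mult[OF antitranspose_carrier antitranspose_carrier] by (metis det_one)
  then show ?thesis by (auto simp: carrier_GL)
qed

lemma antitranspose_unitriangular:
  "A \<in> unitriangular n \<Longrightarrow> antitranspose n A \<in> unitriangular n"
  by (auto simp: unitriangular_iff)

text \<open>The superdiagonal is only reversed, and the character sees nothing but its sum.\<close>

lemma whittaker_char_antitranspose:
  fixes A :: "'k :: field mat"
  shows "whittaker_char n \<psi> (antitranspose n A) = whittaker_char n \<psi> A"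
proof -
  have "(\<Sum>i<n - 1. antitranspose n A $$ (i, i + 1)) = (\<Sum>i<n - 1. A $$ (n - 1 - Suc i, n - 1 - Suc i + 1))"
    by (intro sum.cong) (auto simp: Suc_diff_Suc)
  also have "\<dots> = (\<Sum>i<n - 1. A $$ (i, i + 1))"
    by (rule sum.nat_diff_reindex)
  finally show ?thesis by (simp add: whittaker_char_def)
qed

lemma whittaker_char_mult:
  assumes \<psi>: "additive_character \<psi>" and A: "A \<in> unitriangular n" and B: "B \<in> unitriangular n"
  shows "whittaker_char n \<psi> (A * B) = whittaker_char n \<psi> A * whittaker_char n \<psi> B"
proof -
  have "(\<Sum>i<n - 1. (A * B) $$ (i, i + 1)) = (\<Sum>i<n - 1. A $$ (i, i + 1) + B $$ (i, i + 1))"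
    using unitriangular_mult(2)[OF A B] by (intro sum.cong) auto
  then show ?thesis
    by (simp add: whittaker_char_def sum.distrib additive_character_add[OF \<psi>])
qed

lemma whittaker_char_one:
  assumes \<psi>: "additive_character \<psi>"
  shows "whittaker_char n \<psi> (1\<^sub>m n) = 1"
proof -
  have "(\<Sum>i<n - 1. (1\<^sub>m n :: 'a mat) $$ (i, i + 1)) = 0" by (intro sum.neutral) auto
  then show ?thesis unfolding whittaker_char_def by (simp only: additive_character_add(2)[OF \<psi>])
qed

section \<open>Bruhat decomposition and Whittaker functions\<close>

definition row_shear :: "nat \<Rightarrow> nat \<Rightarrow> (nat \<Rightarrow> 'k) \<Rightarrow> 'k :: field mat"
  where "row_shear n r c = mat n n (\<lambda>(i, j). if i = j then 1 else if j = r \<and> i < r then c i else 0)"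

definition col_shear :: "nat \<Rightarrow> nat \<Rightarrow> (nat \<Rightarrow> 'k) \<Rightarrow> 'k :: field mat"
  where "col_shear n k d = mat n n (\<lambda>(i, j). if i = j then 1 else if i = k \<and> k < j then d j else 0)"

lemma row_shear_unitriangular: "row_shear n r c \<in> unitriangular n"
  by (auto simp: unitriangular_iff row_shear_def)

lemma col_shear_unitriangular: "col_shear n k d \<in> unitriangular n"
  by (auto simp: unitriangular_iff col_shear_def)

lemma row_shear_mult:
  assumes A: "A \<in> carrier_mat n n" and "r < n" "i < n" "j < n"
  shows "(row_shear n r c * A) $$ (i, j) = A $$ (i, j) + (if i < r then c i * A $$ (r, j) else 0)"
proof -
  have "(row_shear n r c * A) $$ (i, j) = (\<Sum>k<n. row_shear n r c $$ (i, k) * A $$ (k, j))"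
    using assms by (intro mat_mult_entry) (auto simp: row_shear_def)
  also have "\<dots> = (\<Sum>k<n. (if k = i then A $$ (i, j) else 0)
      + (if k = r then (if i < r then c i * A $$ (r, j) else 0) else 0))"
    using assms by (intro sum.cong) (auto simp: row_shear_def)
  finally show ?thesis using assms by (simp add: sum.distrib)
qed

lemma mult_col_shear:
  assumes A: "A \<in> carrier_mat n n" and "k < n" "i < n" "j < n"
  shows "(A * col_shear n k d) $$ (i, j) = A $$ (i, j) + (if k < j then A $$ (i, k) * d j else 0)"
proof -
  have "(A * col_shear n k d) $$ (i, j) = (\<Sum>m<n. A $$ (i, m) * col_shear n k d $$ (m, j))"
    using assms by (intro mat_mult_entry) (auto simp: col_shear_def)
  also have "\<dots> = (\<Sum>m<n. (if m = j then A $$ (i, j) else 0)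
      + (if m = k then (if k < j then A $$ (i, k) * d j else 0) else 0))"
    using assms by (intro sum.cong) (auto simp: col_shear_def)
  finally show ?thesis using assms by (simp add: sum.distrib)
qed

text \<open>A matrix with a pivot in every column is monomial. Pivots in the first \<open>k\<close>
  columns are the invariant of the elimination behind the Bruhat decomposition.\<close>

definition pivot :: "nat \<Rightarrow> 'k :: field mat \<Rightarrow> nat \<Rightarrow> nat \<Rightarrow> bool"
  where "pivot n A r j \<longleftrightarrow> r < n \<and> A $$ (r, j) \<noteq> 0 \<and>
    (\<forall>i<n. i \<noteq> r \<longrightarrow> A $$ (i, j) = 0) \<and> (\<forall>m<n. m \<noteq> j \<longrightarrow> A $$ (r, m) = 0)"

text \<open>Factors from \<open>U\<close> add rows to rows above on the left, and columns to later
  columns on the right. Clearing the columns from left to right, each from its lowest nonzero entry,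
  uses only these operations.\<close>

lemma bruhat_step:
  fixes A :: "'k :: field mat"
  assumes A: "A \<in> carrier (GL n)" and k: "k < n" and clean: "\<forall>j<k. \<exists>r. pivot n A r j"
  shows "\<exists>u\<in>unitriangular n. \<exists>v\<in>unitriangular n. \<forall>j<Suc k. \<exists>r. pivot n (u * A * v) r j"
proof -
  interpret group "GL n :: 'k mat monoid" by (rule group_GL)
  note Ac = GL_carrier_mat[OF A]
  have "\<exists>i<n. A $$ (i, k) \<noteq> 0"
  proof (rule ccontr)
    assume 0: "\<not> (\<exists>i<n. A $$ (i, k) \<noteq> 0)"
    have "inv\<^bsub>GL n\<^esub> A * A = 1\<^sub>m n" using l_inv[OF A] by simp
    then have "1 = (inv\<^bsub>GL n\<^esub> A * A) $$ (k, k)" using k by simp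
    also have "\<dots> = (\<Sum>m<n. (inv\<^bsub>GL n\<^esub> A) $$ (k, m) * A $$ (m, k))"
      by (rule mat_mult_entry[OF GL_carrier_mat[OF inv_closed[OF A]] Ac k k])
    also have "\<dots> = 0" using 0 by (intro sum.neutral) auto
    finally show False by simp
  qed
  \<comment> \<open>The lowest nonzero entry of column \<open>k\<close>: all others lie above it and
    can be cleared by adding multiples of row \<open>r\<close>.\<close>
  define r where "r = Max {i. i < n \<and> A $$ (i, k) \<noteq> 0}"
  have "r \<in> {i. i < n \<and> A $$ (i, k) \<noteq> 0}"
    unfolding r_def using \<open>\<exists>i<n. _\<close> by (intro Max_in) auto
  then have r: "r < n" "A $$ (r, k) \<noteq> 0" by auto
  have above: "A $$ (i, k) = 0" if "r < i" "i < n" for i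
  proof (rule ccontr)
    assume "A $$ (i, k) \<noteq> 0"
    then have "i \<le> r" unfolding r_def using that by (intro Max_ge) auto
    with that show False by simp
  qed
  define c where "c i = - (A $$ (i, k) / A $$ (r, k))" for i
  define B where "B = row_shear n r c * A"
  have Bc: "B \<in> carrier_mat n n"
    unfolding B_def using Ac by (auto simp: row_shear_def)
  have B: "B $$ (i, j) = A $$ (i, j) + (if i < r then c i * A $$ (r, j) else 0)"
    if "i < n" "j < n" for i j
    unfolding B_def by (rule row_shear_mult[OF Ac r(1) that])
  \<comment> \<open>After the row step, column \<open>k\<close> is zero outside row
    \<open>r\<close>, so adding its multiples to later columns changes row \<open>r\<close>
    alone.\<close>
  define d where "d j = - (B $$ (r, j) / B $$ (r, k))" for j
  define C where "C = B * col_shear n k d"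
  have C: "C $$ (i, j) = B $$ (i, j) + (if k < j then B $$ (i, k) * d j else 0)"
    if "i < n" "j < n" for i j
    unfolding C_def by (rule mult_col_shear[OF Bc k that])
  have B_col: "B $$ (i, k) = (if i = r then A $$ (r, k) else 0)" if "i < n" for i
    using B[OF that k] above[of i] that r by (cases i r rule: linorder_cases) (auto simp: c_def)
  \<comment> \<open>Row \<open>s\<close> vanishes in column \<open>k\<close>, so
    \<open>s \<noteq> r\<close> and neither operation touches row \<open>s\<close>. Row
    \<open>r\<close> vanishes in column \<open>j\<close>, so that column is not touched
    either.\<close>
  have old: "pivot n C s j" if j: "j < k" and s: "pivot n A s j" for j s
  proof -
    have jn: "j < n" using j k by simp
    have s': "s < n" "A $$ (s, j) \<noteq> 0" "\<And>i. i < n \<Longrightarrow> i \<noteq> s \<Longrightarrow> A $$ (i, j) = 0"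
      "\<And>m. m < n \<Longrightarrow> m \<noteq> j \<Longrightarrow> A $$ (s, m) = 0"
      using s by (auto simp: pivot_def)
    have sk: "A $$ (s, k) = 0" using s'(4)[of k] j k by simp
    then have sr: "s \<noteq> r" using r by auto
    have col: "C $$ (i, j) = A $$ (i, j)" if "i < n" for i
      using C[OF that jn] B[OF that jn] s'(3)[OF r(1)] sr j by simp
    have row: "C $$ (s, m) = A $$ (s, m)" if "m < n" for m
      using C[OF s'(1) that] B[OF s'(1) that] B_col[OF s'(1)] sr sk by (simp add: c_def)
    show ?thesis using s' jn by (simp add: pivot_def col row)
  qed
  have new: "pivot n C r k"
  proof -
    have col: "C $$ (i, k) = (if i = r then A $$ (r, k) else 0)" if "i < n" for i
      using C[OF that k] B_col[OF that] by simp
    \<comment> \<open>To the right of \<open>k\<close> the entry is cleared by \<open>d\<close>. To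
      the left it was zero before, as the pivot of that column lies in another row.\<close>
    have row: "C $$ (r, m) = 0" if m: "m < n" "m \<noteq> k" for m
    proof (cases "k < m")
      case True
      then show ?thesis using C[OF r(1) m(1)] B_col[OF r(1)] r by (simp add: d_def)
    next
      case False
      with m have mk: "m < k" by simp
      then obtain s where s: "pivot n A s m" using clean by blast
      have "A $$ (s, k) = 0" using s mk k by (auto simp: pivot_def)
      then have "r \<noteq> s" using r by auto
      then have "A $$ (r, m) = 0" using s r(1) by (simp add: pivot_def)
      then show ?thesis using C[OF r(1) m(1)] B[OF r(1) m(1)] False by simp
    qed
    show ?thesis using r row col by (simp add: pivot_def)
  qed
  have "\<forall>j<Suc k. \<exists>r. pivot n C r j"
    using old new clean by (metis less_Suc_eq)
  then show ?thesis
    unfolding C_def B_def using row_shear_unitriangular col_shear_unitriangular by blast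
qed

lemma pivot_unique:
  assumes "pivot n w r j" "pivot n w r k" "k < n"
  shows "j = k"
  using assms unfolding pivot_def by metis

lemma pivots_bij:
  assumes "\<forall>j<n. \<exists>r. pivot n w r j"
  obtains \<sigma> where "\<And>j. j < n \<Longrightarrow> pivot n w (\<sigma> j) j" "bij_betw \<sigma> {..<n} {..<n}"
proof -
  obtain \<sigma> where \<sigma>: "\<And>j. j < n \<Longrightarrow> pivot n w (\<sigma> j) j" using assms by metis
  have "inj_on \<sigma> {..<n}"
  proof (rule inj_onI)
    fix j k assume "j \<in> {..<n}" "k \<in> {..<n}" "\<sigma> j = \<sigma> k"
    then show "j = k" using \<sigma>[of j] \<sigma>[of k] by (intro pivot_unique[of n w "\<sigma> k"]) simp_all
  qed
  moreover have "\<sigma> ` {..<n} \<subseteq> {..<n}" using \<sigma> by (auto simp: pivot_def)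
  ultimately have "bij_betw \<sigma> {..<n} {..<n}"
    unfolding bij_betw_def by (simp add: endo_inj_surj)
  with \<sigma> show ?thesis using that by blast
qed

lemma pivots_antitranspose:
  assumes "\<forall>j<n. \<exists>r. pivot n w r j"
  shows "\<forall>j<n. \<exists>r. pivot n (antitranspose n w) r j"
proof (intro allI impI)
  fix j assume j: "j < n"
  obtain \<sigma> where \<sigma>: "\<And>j. j < n \<Longrightarrow> pivot n w (\<sigma> j) j" "bij_betw \<sigma> {..<n} {..<n}"
    using pivots_bij[OF assms] by blast
  \<comment> \<open>Column \<open>j\<close> of the antitranspose is row \<open>n - Suc j\<close> of
    \<open>w\<close> read backwards, so the pivot of that row is wanted.\<close>
  have "n - Suc j \<in> \<sigma> ` {..<n}" using bij_betw_imp_surj_on[OF \<sigma>(2)] j by simp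
  then obtain m where m: "m < n" "\<sigma> m = n - Suc j" by auto
  have "pivot n w (n - Suc j) m" using \<sigma>(1)[OF m(1)] m(2) by simp
  then have "pivot n (antitranspose n w) (n - Suc m) j"
    using j m(1) unfolding pivot_def
    by (auto simp: Suc_diff_Suc)
  then show "\<exists>r. pivot n (antitranspose n w) r j" ..
qed

section \<open>Symmetry of functions on the general linear group that are equivariant on both
  sides\<close>

locale whittaker_function =
  fixes n :: nat and \<psi> :: "'k :: field \<Rightarrow> 'f :: field" and f :: "'k mat \<Rightarrow> 'f"
  assumes \<psi>: "additive_character \<psi>" and nontrivial: "\<exists>x. \<psi> x \<noteq> 1"
    and left: "\<And>g u. g \<in> carrier (GL n) \<Longrightarrow> u \<in> unitriangular n \<Longrightarrow>
      f (u * g) * whittaker_char n \<psi> u = f g"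
    and right: "\<And>g u. g \<in> carrier (GL n) \<Longrightarrow> u \<in> unitriangular n \<Longrightarrow>
      f (g * u) * whittaker_char n \<psi> u = f g"
begin

text \<open>If \<open>w \<in> GL n\<close> is monomial with entries \<open>t a\<close> at \<open>(\<sigma> a, a)\<close> and \<open>\<sigma> a < \<sigma> (a + 1)\<close>, then the
  root subgroup of \<open>(a, a + 1)\<close> is conjugated by \<open>w\<close> to another upper triangular one.\<close>

lemma support_condition:
  assumes w: "w \<in> carrier (GL n)" and fw: "f w \<noteq> 0" and a: "Suc a < n"
    and p: "pivot n w p a" and q: "pivot n w q (Suc a)" and pq: "p < q"
  shows "q = Suc p \<and> w $$ (p, a) = w $$ (q, Suc a)"
proof -
  define t where "t = w $$ (p, a)"
  define t' where "t' = w $$ (q, Suc a)"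
  have t: "t \<noteq> 0" "t' \<noteq> 0" "p < n" "q < n" using p q by (auto simp: pivot_def t_def t'_def)
  \<comment> \<open>Equivariance applied to \<open>w * R = L * w\<close> and
    \<open>f w \<noteq> 0\<close> give \<open>R\<close> and \<open>L\<close> the same character
    value. The value at \<open>L\<close> involves \<open>\<psi>\<close> only if position
    \<open>(p, q)\<close> is on the superdiagonal.\<close>
  have eq: "\<psi> x = (if q = Suc p then \<psi> (x * t / t') else 1)" for x
  proof -
    define R :: "'k mat" where "R = col_shear n a (\<lambda>j. if j = Suc a then x else 0)"
    \<comment> \<open>With the factor \<open>x * t / t'\<close>, both \<open>w * R\<close> and
      \<open>L * w\<close> are \<open>w\<close> with \<open>x * t\<close> added at position
      \<open>(p, Suc a)\<close>.\<close>
    define L :: "'k mat" where "L = row_shear n q (\<lambda>i. if i = p then x * t / t' else 0)"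
    have U: "R \<in> unitriangular n" "L \<in> unitriangular n"
      unfolding R_def L_def by (rule col_shear_unitriangular row_shear_unitriangular)+
    note wc = GL_carrier_mat[OF w]
    have "w * R = L * w"
    proof (rule eq_matI)
      fix i j assume "i < dim_row (L * w)" "j < dim_col (L * w)"
      then have ij: "i < n" "j < n" using wc by (auto simp: L_def row_shear_def)
      have "w $$ (i, a) = 0" if "i \<noteq> p" using p that ij by (simp add: pivot_def)
      moreover have "w $$ (q, j) = 0" if "j \<noteq> Suc a" using q that ij by (simp add: pivot_def)
      ultimately show "(w * R) $$ (i, j) = (L * w) $$ (i, j)"
        unfolding R_def L_def using ij a t pq
        by (simp add: mult_col_shear[OF wc] row_shear_mult[OF wc] t_def t'_def)
    qed (use wc in \<open>auto simp: L_def R_def row_shear_def col_shear_def\<close>)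
    then have "f w = f (w * R) * whittaker_char n \<psi> R" "f w = f (w * R) * whittaker_char n \<psi> L"
      using left[OF w U(2)] right[OF w U(1)] by auto
    then have "whittaker_char n \<psi> R = whittaker_char n \<psi> L" using fw by auto
    moreover have "whittaker_char n \<psi> R = \<psi> x"
    proof -
      have "(\<Sum>i<n - 1. R $$ (i, i + 1)) = (\<Sum>i<n - 1. if i = a then x else 0)"
        by (intro sum.cong) (auto simp: R_def col_shear_def)
      moreover have "a < n - 1" using a by simp
      ultimately show ?thesis by (simp add: whittaker_char_def)
    qed
    moreover have "whittaker_char n \<psi> L = (if q = Suc p then \<psi> (x * t / t') else 1)"
    proof -
      have "(\<Sum>i<n - 1. L $$ (i, i + 1)) = (\<Sum>i<n - 1. if i = p then (if q = Suc p then x * t / t' else 0) else 0)"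
        by (intro sum.cong) (auto simp: L_def row_shear_def)
      also have "\<dots> = (if q = Suc p then x * t / t' else 0)" using t pq by auto
      finally show ?thesis by (simp add: whittaker_char_def additive_character_add(2)[OF \<psi>])
    qed
    ultimately show ?thesis by simp
  qed
  have q': "q = Suc p" using eq nontrivial by metis
  have "t = t'"
  proof (rule ccontr)
    assume "t \<noteq> t'"
    then have ne: "1 - t / t' \<noteq> 0" using t by simp
    have "\<psi> y = 1" for y
    proof -
      \<comment> \<open>Chosen so that \<open>x - x * t / t' = y\<close>. By \<open>eq\<close> all
        such differences have value 1 under \<open>\<psi>\<close>, and for
        \<open>t \<noteq> t'\<close> they fill the field.\<close>
      define x where "x = y / (1 - t / t')"
      have "x * (1 - t / t') = y" using ne by (simp add: x_def)
      then have "x = y + x * t / t'" by (auto simp: right_diff_distrib)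
      then have "\<psi> x = \<psi> y * \<psi> (x * t / t')" using additive_character_add(1)[OF \<psi>] by metis
      moreover have "\<psi> x = \<psi> (x * t / t')" using eq[of x] q' by simp
      ultimately show ?thesis using additive_character_add(3)[OF \<psi>, of x] by simp
    qed
    with nontrivial show False by blast
  qed
  with q' show ?thesis by (simp add: t_def t'_def)
qed

text \<open>Reversing the order of the rows turns the condition on ascents of
  \<open>\<sigma>\<close> into the condition on descents of \<open>\<rho>\<close> required by
  \<open>involution_of_descents\<close>. Symmetry of \<open>w\<close> about the antidiagonal says
  exactly that \<open>\<rho>\<close> is an involution preserving the entries
  \<open>t\<close>.\<close>

lemma monomial_symmetric:
  assumes w: "w \<in> carrier (GL n)" and fw: "f w \<noteq> 0" and monomial: "\<forall>j<n. \<exists>r. pivot n w r j"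
  shows "antitranspose n w = w"
proof -
  obtain \<sigma> where \<sigma>: "\<And>j. j < n \<Longrightarrow> pivot n w (\<sigma> j) j" using monomial by metis
  have lt: "\<sigma> j < n" if "j < n" for j using \<sigma>[OF that] by (simp add: pivot_def)
  have zero: "w $$ (i, j) = 0" if "i < n" "j < n" "i \<noteq> \<sigma> j" for i j
    using \<sigma>[OF that(2)] that by (simp add: pivot_def)
  have nz: "w $$ (\<sigma> j, j) \<noteq> 0" if "j < n" for j using \<sigma>[OF that] by (simp add: pivot_def)
  have \<sigma>_inj: "j = k" if "\<sigma> j = \<sigma> k" "j < n" "k < n" for j k
    using \<sigma>[OF that(2)] \<sigma>[OF that(3)] that by (intro pivot_unique[of n w "\<sigma> k"]) simp_all
  define \<rho> where "\<rho> j = n - Suc (\<sigma> j)" for j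
  define t where "t j = w $$ (\<sigma> j, j)" for j
  have \<rho>_lt: "\<rho> j < n" if "j < n" for j using that by (simp add: \<rho>_def)
  have \<sigma>_\<rho>: "\<sigma> j = n - Suc (\<rho> j)" if "j < n" for j using lt[OF that] by (simp add: \<rho>_def)
  have "inj_on \<rho> {..<n}"
    by (rule inj_onI) (metis \<sigma>_\<rho> \<sigma>_inj lessThan_iff)
  then have "bij_betw \<rho> {..<n} {..<n}"
    unfolding bij_betw_def using \<rho>_lt by (intro conjI endo_inj_surj) auto
  moreover have "\<rho> a < \<rho> (Suc a) \<or> (\<rho> a = Suc (\<rho> (Suc a)) \<and> t a = t (Suc a))" if a: "Suc a < n" for a
  proof -
    have ne: "\<sigma> a \<noteq> \<sigma> (Suc a)" using \<sigma>_inj[of a "Suc a"] a by auto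
    show ?thesis
    proof (cases "\<sigma> a < \<sigma> (Suc a)")
      case True
      then have "\<sigma> (Suc a) = Suc (\<sigma> a) \<and> t a = t (Suc a)"
        unfolding t_def using support_condition[OF w fw a \<sigma> \<sigma>] a by simp
      then show ?thesis using lt[OF a] by (simp add: \<rho>_def Suc_diff_Suc)
    next
      case False
      then have "\<rho> a < \<rho> (Suc a)" using ne lt[of a] a unfolding \<rho>_def by linarith
      then show ?thesis ..
    qed
  qed
  ultimately have inv: "\<rho> (\<rho> j) = j" "t (\<rho> j) = t j" if "j < n" for j
    using involution_of_descents[of \<rho> n t j] that by blast+
  show ?thesis
  proof (rule eq_matI)
    fix i j assume "i < dim_row w" "j < dim_col w"
    then have ij: "i < n" "j < n" using GL_carrier_mat[OF w] by auto
    have "w $$ (n - Suc j, n - Suc i) = w $$ (i, j)"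
    proof (cases "i = \<sigma> j")
      case True
      then have "n - Suc i = \<rho> j" by (simp add: \<rho>_def)
      moreover have "n - Suc j = \<sigma> (\<rho> j)" using \<sigma>_\<rho>[OF \<rho>_lt[OF ij(2)]] inv(1)[OF ij(2)] by simp
      ultimately show ?thesis using inv(2)[OF ij(2)] True by (simp add: t_def)
    next
      case False
      have "n - Suc j \<noteq> \<sigma> (n - Suc i)"
      proof
        assume eq: "n - Suc j = \<sigma> (n - Suc i)"
        have "n - Suc i < n" using ij by simp
        then have "\<rho> (n - Suc i) = j" using eq ij by (simp add: \<rho>_def flip: eq)
        then have "\<rho> j = n - Suc i" using inv(1)[OF \<open>n - Suc i < n\<close>] by simp
        then have "\<sigma> j = i" using \<sigma>_\<rho>[OF ij(2)] ij by simp
        with False show False by simp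
      qed
      then show ?thesis using zero[of "n - Suc j" "n - Suc i"] zero[OF ij False] ij by simp
    qed
    then show "antitranspose n w $$ (i, j) = w $$ (i, j)" using ij by simp
  qed (use GL_carrier_mat[OF w] in \<open>auto simp: antitranspose_def\<close>)
qed

text \<open>Induction downwards on the number \<open>k\<close> of leading columns with a pivot, from
  monomial matrices at \<open>k = n\<close> to arbitrary ones at \<open>k = 0\<close>.\<close>

lemma f_antitranspose:
  assumes "g \<in> carrier (GL n)"
  shows "f (antitranspose n g) = f g"
proof -
  have "f (antitranspose n g) = f g"
    if "k \<le> n" "g \<in> carrier (GL n)" "\<forall>j<k. \<exists>r. pivot n g r j" for k g
    using that
  proof (induction k arbitrary: g rule: inc_induct)
    case base
    \<comment> \<open>Both \<open>g\<close> and its antitranspose are monomial. If \<open>f\<close>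
      is nonzero at one of them, the two matrices coincide; otherwise both values are 0.\<close>
    then show ?case
      using monomial_symmetric[of g] monomial_symmetric[OF antitranspose_GL[OF base(1)]]
        pivots_antitranspose[of n g] antitranspose_antitranspose[OF GL_carrier_mat[OF base(1)]]
      by metis
  next
    case (step k)
    obtain u v where uv: "u \<in> unitriangular n" "v \<in> unitriangular n"
      and clean: "\<forall>j<Suc k. \<exists>r. pivot n (u * g * v) r j"
      using bruhat_step[OF step.prems(1) step.hyps(2) step.prems(2)] by blast
    interpret group "GL n :: 'k mat monoid" by (rule group_GL)
    let ?\<eta> = "whittaker_char n \<psi>" and ?\<tau> = "antitranspose n"
    have G: "u \<in> carrier (GL n)" "v \<in> carrier (GL n)" using uv unitriangular_subset by auto
    have ug: "u * g \<in> carrier (GL n)" "u * g * v \<in> carrier (GL n)"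
      using m_closed[OF G(1) step.prems(1)] m_closed[OF m_closed[OF G(1) step.prems(1)] G(2)] by simp_all
    have \<tau>: "?\<tau> (u * g * v) = ?\<tau> v * (?\<tau> g * ?\<tau> u)"
      using antitranspose_mult[OF GL_carrier_mat[OF ug(1)] GL_carrier_mat[OF G(2)]]
        antitranspose_mult[OF GL_carrier_mat[OF G(1)] GL_carrier_mat[OF step.prems(1)]] by simp
    have \<tau>gu: "?\<tau> g * ?\<tau> u \<in> carrier (GL n)"
      using m_closed[OF antitranspose_GL[OF step.prems(1)] antitranspose_GL[OF G(1)]] by simp
    \<comment> \<open>The antitranspose exchanges the sides of \<open>u\<close> and \<open>v\<close>
      but keeps them in \<open>U\<close> with the same character values, so \<open>f g\<close> and
      the value at the antitranspose of \<open>g\<close> pick up the same factor.\<close>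
    have "f (u * g * v) * ?\<eta> v * ?\<eta> u = f g"
      using right[OF ug(1) uv(2)] left[OF step.prems(1) uv(1)] by simp
    moreover have "f (?\<tau> (u * g * v)) * ?\<eta> v * ?\<eta> u = f (?\<tau> g)"
      using left[OF \<tau>gu antitranspose_unitriangular[OF uv(2)]]
        right[OF antitranspose_GL[OF step.prems(1)] antitranspose_unitriangular[OF uv(1)]]
      by (simp add: \<tau> whittaker_char_antitranspose)
    moreover have "f (?\<tau> (u * g * v)) = f (u * g * v)"
      by (rule step.IH[OF ug(2) clean])
    ultimately show ?case by simp
  qed
  from this[of 0 g] show ?thesis using assms by simp
qed

end

text \<open>Nontriviality of \<open>\<psi>\<close> enters twice: it makes the order of
  \<open>U\<close> invertible, and it restricts the support of the functions in the Hecke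
  algebra.\<close>

lemma commutative_hecke_algebra_GL:
  fixes \<psi> :: "'k :: {field, finite} \<Rightarrow> 'f :: alg_closed_field"
  assumes \<psi>: "additive_character \<psi>" and nontrivial: "\<exists>x. \<psi> x \<noteq> 1"
  shows "commutative_hecke_algebra (GL n) (unitriangular n) (whittaker_char n \<psi>)"
proof -
  have character: "finite_group_character (GL n) (unitriangular n) (whittaker_char n \<psi>)"
  proof (intro finite_group_character.intro finite_group.intro finite_group_axioms.intro
      finite_group_character_axioms.intro group_GL subgroup_unitriangular)
    show "finite (carrier (GL n :: 'k mat monoid))"
      by (rule finite_subset[OF _ finite_carrier_mat[of n n]]) (auto simp: carrier_GL)
    obtain N where "card (unitriangular n :: 'k mat set) = card (UNIV :: 'k set) ^ N"
      using card_unitriangular by blast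
    then show "of_nat (card (unitriangular n :: 'k mat set)) \<noteq> (0 :: 'f)"
      using card_field_nonzero[OF \<psi> nontrivial] by simp
  qed (simp_all add: whittaker_char_mult[OF \<psi>] whittaker_char_one[OF \<psi>])
  have \<tau>: "antitranspose n g \<in> carrier (GL n)" "antitranspose n (antitranspose n g) = g"
    if "g \<in> carrier (GL n)" for g :: "'k mat"
    using that by (simp_all add: antitranspose_GL antitranspose_antitranspose GL_carrier_mat)
  have \<tau>_mult: "antitranspose n (g \<otimes>\<^bsub>GL n\<^esub> h) = antitranspose n h \<otimes>\<^bsub>GL n\<^esub> antitranspose n g"
    if "g \<in> carrier (GL n)" "h \<in> carrier (GL n)" for g h :: "'k mat"
    using that by (simp add: antitranspose_mult GL_carrier_mat)
  have invariant: "x (antitranspose n g) = x g"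
    if "\<And>g u. g \<in> carrier (GL n) \<Longrightarrow> u \<in> unitriangular n \<Longrightarrow>
        x (u \<otimes>\<^bsub>GL n\<^esub> g) * whittaker_char n \<psi> u = x g"
      "\<And>g u. g \<in> carrier (GL n) \<Longrightarrow> u \<in> unitriangular n \<Longrightarrow>
        x (g \<otimes>\<^bsub>GL n\<^esub> u) * whittaker_char n \<psi> u = x g"
      "g \<in> carrier (GL n)" for x :: "'k mat \<Rightarrow> 'f" and g
  proof -
    interpret whittaker_function n \<psi> x
      using that(1,2) \<psi> nontrivial by unfold_locales simp_all
    show ?thesis using that(3) by (rule f_antitranspose)
  qed
  show ?thesis
  proof (intro commutative_hecke_algebra.intro character commutative_hecke_algebra_axioms.intro)
  qed (rule finite_group_character.hecke_commute_of_anti_involution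
      [OF character, of "antitranspose n", OF \<tau> \<tau>_mult invariant])
qed

theorem corollary1p9:
  fixes l n :: nat
    and P :: "'f :: alg_closed_field set"
    and \<psi> :: "'k :: {field, finite} \<Rightarrow> 'f"
    and V :: "('f, 'v) module"
    and \<rho> :: "'k mat \<Rightarrow> 'v \<Rightarrow> 'v"
  assumes "prime l"
    and "algebraic_closure (class_ring :: 'f ring) P" and "card P = l"
    and "n \<ge> 2"
    and "irreducible_representation (GL n :: 'k mat monoid) V \<rho>"
    and "additive_character \<psi>" and "\<exists>x. \<psi> x \<noteq> 1"
  shows "at_most_one_Whittaker_model n \<psi> V \<rho>"
proof -
  interpret irreducible_into_ind "GL n" "unitriangular n" "whittaker_char n \<psi>" V \<rho>
    using commutative_hecke_algebra_GL[OF assms(6,7)] assms(5) by (rule irreducible_into_ind.intro)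
  show ?thesis
    using dim_Hom_le_1 unfolding at_most_one_Whittaker_model_def Whittaker_Hom_def .
qed

end
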